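(* Let $A, B \subseteq \omega$ with $B$ infinite, and suppose that $A$ is c.e. relative to every infinite subset of $B$. Suppose moreover that either (a) $\omega_1^B = \omega_1^{\mathrm{ck}}$, or (b) $A$ is infinite and $A$ is c.e. relative to every infinite subset of $A$. Then there is an infinite $C \subseteq B$ and a single Turing functional $\Phi$ such that $\Phi(S) = A$ for every infinite $S \subseteq C$.
   Context: $\omega_1^B$ is the least ordinal not computable relative to $B$ (the least non-$B$-computable ordinal), and $\omega_1^{\mathrm{ck}}$ is the least non-computable ordinal. *)

theory Defs
  imports Main
begin

text \<open>Codes of partial recursive functionals with a set oracle (Kleene schemes).
  A code of type recf plays the role of a Turing functional / oracle program index.\<close>

datatype recf =
    Zero
  | Succ
  | Proj nat
  | Comp recf "recf list"
  | PrimRec recf recf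
  | Minimize recf
  | Orc

inductive eval :: "nat set \<Rightarrow> recf \<Rightarrow> nat list \<Rightarrow> nat \<Rightarrow> bool" for X :: "nat set" where
  ev_zero: "eval X Zero xs 0"
| ev_succ: "eval X Succ (x # xs) (Suc x)"
| ev_proj: "i < length xs \<Longrightarrow> eval X (Proj i) xs (xs ! i)"
| ev_comp: "list_all2 (\<lambda>g y. eval X g xs y) gs ys \<Longrightarrow> eval X f ys z \<Longrightarrow> eval X (Comp f gs) xs z"
| ev_prim0: "eval X f xs y \<Longrightarrow> eval X (PrimRec f g) (0 # xs) y"
| ev_primS: "eval X (PrimRec f g) (n # xs) y \<Longrightarrow> eval X g (n # y # xs) z
              \<Longrightarrow> eval X (PrimRec f g) (Suc n # xs) z"
| ev_min: "eval X f (n # xs) 0 \<Longrightarrow> (\<forall>m<n. \<exists>k. eval X f (m # xs) (Suc k))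
              \<Longrightarrow> eval X (Minimize f) xs n"
| ev_orc: "eval X Orc (x # xs) (if x \<in> X then 1 else 0)"

definition ce_in :: "nat set \<Rightarrow> nat set \<Rightarrow> bool" where
  "ce_in X A \<longleftrightarrow> (\<exists>f. \<forall>n. n \<in> A \<longleftrightarrow> (\<exists>y. eval X f [n] y))"

definition computes :: "nat set \<Rightarrow> recf \<Rightarrow> nat set \<Rightarrow> bool" where
  "computes X Phi A \<longleftrightarrow> (\<forall>n. eval X Phi [n] (if n \<in> A then 1 else 0))"

definition rel_computable :: "nat set \<Rightarrow> (nat \<times> nat) set \<Rightarrow> bool" where
  "rel_computable X r \<longleftrightarrow> (\<exists>f. \<forall>m n. eval X f [m, n] (if (m, n) \<in> r then 1 else 0))"

text \<open>An ordinal is X-computable iff it is the order type of an X-computable well-order on a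
  subset of nat. The X-computable ordinals form an initial segment containing the computable
  ones, so omega_1^X = omega_1^ck iff every X-computable ordinal is computable.\<close>
definition omega1_eq_ck :: "nat set \<Rightarrow> bool" where
  "omega1_eq_ck X \<longleftrightarrow>
     (\<forall>r :: (nat \<times> nat) set. Well_order r \<and> rel_computable X r \<longrightarrow>
        (\<exists>r'. Well_order r' \<and> rel_computable {} r' \<and> (r, r') \<in> ordIso))"

end

(*
Finite-condition forcing yields a finite stem F, one index e and an infinite X \<subseteq> B such that, for every
infinite Y \<subseteq> X, n is in A iff W_e^(F \<union> H) accepts n for some finite H \<subseteq> Y. A promise "n is not
accepted" is only made when it holds for all finite subsets H of the reservoir; being closed under
subsets, such promises make Ramsey-type homogenisation unnecessary at this stage, and only finitely
many B-computable conditions describe the reservoir.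

It remains to bound, computably in S \<subseteq> X, how far into S one must look before rejecting n.

(a) The finite sets compatible with the promises that do not yet accept n form a B-computable tree,
well-founded for n in A. Amalgamating these trees along the Kleene-Brouwer order gives one
B-computable well-order, hence an isomorphic computable one, r. If S is sparse enough to dominate the
r-labels of its own initial segments, the greedy r-descending sequence bounded by the elements of S
outlasts every n in A, and it terminates.

(b) By a clopen Ramsey argument along an ultrafilter, for n, d in A either n is accepted no later than
d on all sparse sets, or strictly later on all of them. If some d in A is at least as slow as
infinitely many n in A, then waiting for d decides this infinite subset of A; as A is c.e. in that
subset, sparseness of S gives A. Otherwise every n in A is accepted before all but finitely many d in
A, so S waits for a large enough d that it has already seen to be in A.
*)

theory Submission
  imports Defs "HOL-Library.Nat_Bijection" "HOL-Library.Countable" "HOL-Library.Infinite_Set"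
begin

text \<open>A uniform enumeration gives no bound on the waiting time: when \<open>S\<close> accepts
  \<open>n\<close> depends on how \<open>S\<close> continues, whereas a sparse \<open>S\<close> can
  dominate only quantities fixed by a number or by a finite part of \<open>S\<close> already seen.
  So time has to be measured otherwise: in (a) by an ordinal that drops with every unsuccessful
  element, in (b) by the appearance of another number on the same \<open>S\<close>. In (a) the order
  must be computable from \<open>B\<close>, but the reservoir \<open>X\<close> comes from a
  non-effective construction and may be far more complex than \<open>B\<close>. The tree is
  therefore defined from \<open>B\<close>, the stem and the promises, without \<open>X\<close>, and
  must still be well-founded. This is why the forcing lemma proves completeness for every infinite
  \<open>Y\<close> that keeps the promises, not merely for subsets of \<open>X\<close>. The passage
  from a \<open>B\<close>-computable to a computable order serves uniformity: a subset of
  \<open>C\<close> need not compute \<open>B\<close>, whereas a computable order is available to all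
  oracles through one code.\<close>

instance recf :: countable by countable_datatype

section \<open>Bounded evaluation and recursive closure properties\<close>

text \<open>The bound \<open>t\<close> limits unbounded searches and oracle queries only; every other scheme is total
  relative to its arguments. This makes evaluation primitive recursive, by recursion on the code,
  without a universal function.\<close>

fun eval_upto :: "nat \<Rightarrow> nat set \<Rightarrow> recf \<Rightarrow> nat list \<Rightarrow> nat option" where
  "eval_upto t X Zero xs = Some 0"
| "eval_upto t X Succ xs = (case xs of [] \<Rightarrow> None | x # _ \<Rightarrow> Some (Suc x))"
| "eval_upto t X (Proj i) xs = (if i < length xs then Some (xs ! i) else None)"
| "eval_upto t X (Comp f gs) xs =
     (if \<exists>g\<in>set gs. eval_upto t X g xs = None then None
      else eval_upto t X f (map (\<lambda>g. the (eval_upto t X g xs)) gs))"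
| "eval_upto t X (PrimRec f g) xs = (case xs of [] \<Rightarrow> None | n # ys \<Rightarrow>
     rec_nat (eval_upto t X f ys)
       (\<lambda>m r. case r of None \<Rightarrow> None | Some y \<Rightarrow> eval_upto t X g (m # y # ys)) n)"
| "eval_upto t X (Minimize f) xs =
     (if \<exists>n<t. eval_upto t X f (n # xs) = Some 0 \<and> (\<forall>m<n. \<exists>k. eval_upto t X f (m # xs) = Some (Suc k))
      then Some (LEAST n. eval_upto t X f (n # xs) = Some 0 \<and> (\<forall>m<n. \<exists>k. eval_upto t X f (m # xs) = Some (Suc k)))
      else None)"
| "eval_upto t X Orc xs = (case xs of [] \<Rightarrow> None | x # _ \<Rightarrow> if x < t then Some (if x \<in> X then 1 else 0) else None)"

text \<open>Existence is bounded by \<open>t\<close> but the \<open>LEAST\<close> is not. They agree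
  because there is at most one witness: every argument below a witness has a successor value, so it
  cannot be a witness itself.\<close>

lemma eval_upto_Minimize_iff:
  "eval_upto t X (Minimize f) xs = Some y \<longleftrightarrow> y < t \<and> eval_upto t X f (y # xs) = Some 0 \<and>
     (\<forall>m<y. \<exists>k. eval_upto t X f (m # xs) = Some (Suc k))"
proof -
  define P where "P n \<longleftrightarrow> eval_upto t X f (n # xs) = Some 0 \<and> (\<forall>m<n. \<exists>k. eval_upto t X f (m # xs) = Some (Suc k))" for n
  have def: "eval_upto t X (Minimize f) xs = (if \<exists>n<t. P n then Some (LEAST n. P n) else None)"
    unfolding P_def by (rule eval_upto.simps)
  have uniq: "m = n" if "P m" "P n" for m n
  proof (rule ccontr)
    assume "m \<noteq> n"
    with that show False unfolding P_def by (metis Zero_not_Suc linorder_neqE_nat option.inject)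
  qed
  have "(\<exists>n<t. P n) \<and> (LEAST n. P n) = y \<longleftrightarrow> y < t \<and> P y"
    using uniq by (metis LeastI)
  then show ?thesis unfolding def by (auto simp: P_def[symmetric])
qed

lemma eval_upto_sound: "eval_upto t X f xs = Some y \<Longrightarrow> eval X f xs y"
proof (induction f arbitrary: xs y)
  case (Comp f gs)
  from Comp.prems have def: "\<forall>g\<in>set gs. eval_upto t X g xs \<noteq> None"
    and f: "eval_upto t X f (map (\<lambda>g. the (eval_upto t X g xs)) gs) = Some y"
    by (auto split: if_splits)
  have "list_all2 (\<lambda>g y. eval X g xs y) gs (map (\<lambda>g. the (eval_upto t X g xs)) gs)"
    unfolding list.rel_map list.rel_refl_strong using def Comp.IH(2)
    by (intro list.rel_refl_strong) auto
  then show ?case using Comp.IH(1)[OF f] by (rule ev_comp)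
next
  case (PrimRec f g)
  from PrimRec.prems obtain n ys where xs: "xs = n # ys" by (auto split: list.splits)
  from PrimRec.prems show ?case unfolding xs
  proof (induction n arbitrary: y)
    case 0
    then show ?case using PrimRec.IH(1) by (auto intro: ev_prim0)
  next
    case (Suc n)
    then obtain z where z: "eval_upto t X (PrimRec f g) (n # ys) = Some z"
      and y: "eval_upto t X g (n # z # ys) = Some y"
      by (auto split: option.splits)
    show ?case by (rule ev_primS[OF Suc.IH[OF z] PrimRec.IH(2)[OF y]])
  qed
next
  case (Minimize f)
  then show ?case unfolding eval_upto_Minimize_iff by (intro ev_min) blast+
next
  case Orc
  then show ?case using ev_orc[of X "hd xs" "tl xs"] by (auto split: list.splits if_splits)
qed (auto split: list.splits if_splits intro: eval.intros)

lemma eval_upto_mono: "eval_upto t X f xs = Some y \<Longrightarrow> t \<le> u \<Longrightarrow> eval_upto u X f xs = Some y"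
proof (induction f arbitrary: xs y)
  case (Comp f gs)
  from Comp.prems have def: "\<forall>g\<in>set gs. eval_upto t X g xs \<noteq> None"
    and f: "eval_upto t X f (map (\<lambda>g. the (eval_upto t X g xs)) gs) = Some y"
    by (auto split: if_splits)
  have eq: "eval_upto u X g xs = eval_upto t X g xs" if "g \<in> set gs" for g
    using def that Comp.IH(2) Comp.prems(2) by force
  have "map (\<lambda>g. the (eval_upto u X g xs)) gs = map (\<lambda>g. the (eval_upto t X g xs)) gs"
    using eq by simp
  then show ?case using Comp.IH(1)[OF f Comp.prems(2)] def eq by (simp del: map_eq_conv)
next
  case (PrimRec f g)
  from PrimRec.prems obtain n ys where xs: "xs = n # ys" by (auto split: list.splits)
  from PrimRec.prems(1) show ?case unfolding xs
  proof (induction n arbitrary: y)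
    case 0
    then show ?case using PrimRec.IH(1) PrimRec.prems(2) by auto
  next
    case (Suc n)
    then obtain z where z: "eval_upto t X (PrimRec f g) (n # ys) = Some z"
      and y: "eval_upto t X g (n # z # ys) = Some y"
      by (auto split: option.splits)
    then show ?case using Suc.IH[OF z] PrimRec.IH(2)[OF y PrimRec.prems(2)] by simp
  qed
next
  case (Minimize f)
  then show ?case unfolding eval_upto_Minimize_iff by fastforce
qed (auto split: list.splits if_splits)

lemma eval_upto_complete: "eval X f xs y \<Longrightarrow> \<exists>t. eval_upto t X f xs = Some y"
proof (induction rule: eval.induct)
  case (ev_comp xs gs ys f z)
  have "\<exists>t. list_all2 (\<lambda>g y. eval_upto t X g xs = Some y) gs ys"
    using ev_comp(1)
  proof (induction rule: list_all2_induct)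
    case (Cons g gs y ys)
    then obtain t u where "list_all2 (\<lambda>g y. eval_upto t X g xs = Some y) gs ys" "eval_upto u X g xs = Some y" by blast
    then have "list_all2 (\<lambda>g y. eval_upto (max t u) X g xs = Some y) (g # gs) (y # ys)"
      by (auto elim!: list_all2_mono intro: eval_upto_mono)
    then show ?case by blast
  qed auto
  then obtain t where t: "list_all2 (\<lambda>g y. eval_upto t X g xs = Some y) gs ys" by blast
  obtain u where u: "eval_upto u X f ys = Some z" using ev_comp by blast
  let ?m = "max t u"
  have gs: "list_all2 (\<lambda>g y. eval_upto ?m X g xs = Some y) gs ys"
    using t by (auto elim!: list_all2_mono intro: eval_upto_mono)
  have "ys = map (\<lambda>g. the (eval_upto ?m X g xs)) gs" "\<forall>g\<in>set gs. eval_upto ?m X g xs \<noteq> None"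
    using gs by (induction rule: list_all2_induct) auto
  moreover have "eval_upto ?m X f ys = Some z" using u by (auto intro: eval_upto_mono)
  ultimately show ?case by (intro exI[of _ ?m]) auto
next
  case (ev_primS f g n xs y z)
  then obtain t u where "eval_upto t X (PrimRec f g) (n # xs) = Some y"
    "eval_upto u X g (n # y # xs) = Some z" by blast
  then have "eval_upto (max t u) X (PrimRec f g) (n # xs) = Some y"
    "eval_upto (max t u) X g (n # y # xs) = Some z" by (blast intro: eval_upto_mono max.cobounded1 max.cobounded2)+
  then show ?case by (intro exI[of _ "max t u"]) auto
next
  case (ev_min f n xs)
  then obtain t0 where t0: "eval_upto t0 X f (n # xs) = Some 0" by blast
  from ev_min obtain k u where ku: "\<And>m. m < n \<Longrightarrow> eval_upto (u m) X f (m # xs) = Some (Suc (k m))" by metis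
  define t where "t = max (Suc n) (max t0 (Max (insert 0 (u ` {..<n}))))"
  have um: "u m \<le> t" if "m < n" for m
  proof -
    have "u m \<le> Max (insert 0 (u ` {..<n}))" using that by (intro Max_ge) auto
    then show ?thesis unfolding t_def by auto
  qed
  have "eval_upto t X (Minimize f) xs = Some n"
    unfolding eval_upto_Minimize_iff using eval_upto_mono[OF t0, of t] eval_upto_mono[OF ku um]
    by (auto simp: t_def)
  then show ?case by blast
next
  case (ev_prim0 f xs y g)
  then show ?case by auto
next
  case (ev_orc x xs)
  then show ?case by (intro exI[of _ "Suc x"]) auto
qed auto

text \<open>The use principle: \<open>t\<close> caps the oracle queries as well. It later allows an
  infinite oracle to be replaced by the code of a finite part of it.\<close>

lemma eval_upto_use: "(\<And>x. x < t \<Longrightarrow> x \<in> X \<longleftrightarrow> x \<in> Y) \<Longrightarrow> eval_upto t X f xs = eval_upto t Y f xs"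
proof (induction f arbitrary: xs)
  case (Comp f gs)
  have "eval_upto t X g xs = eval_upto t Y g xs" if "g \<in> set gs" for g using that Comp by blast
  moreover have "eval_upto t X f ys = eval_upto t Y f ys" for ys using Comp by blast
  ultimately show ?case by (auto cong: map_cong)
next
  case (PrimRec f g)
  have "eval_upto t X f ys = eval_upto t Y f ys" "eval_upto t X g ys = eval_upto t Y g ys" for ys using PrimRec by blast+
  then show ?case by (simp only: eval_upto.simps)
next
  case (Minimize f)
  have "eval_upto t X f ys = eval_upto t Y f ys" for ys using Minimize by blast
  then show ?case by (simp only: eval_upto.simps)
qed (auto split: list.splits)

lemma halts_iff_eval_upto: "(\<exists>y. eval X f xs y) \<longleftrightarrow> (\<exists>t. eval_upto t X f xs \<noteq> None)"
  using eval_upto_sound eval_upto_complete by fastforce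

text \<open>One code has to work for every oracle in \<open>\<O>\<close>.\<close>

definition rfun :: "nat set set \<Rightarrow> nat \<Rightarrow> (nat set \<Rightarrow> nat list \<Rightarrow> nat) \<Rightarrow> bool" where
  "rfun \<O> k f \<longleftrightarrow> (\<exists>c. \<forall>X\<in>\<O>. \<forall>xs. length xs = k \<longrightarrow> eval X c xs (f X xs))"

definition rpred :: "nat set set \<Rightarrow> nat \<Rightarrow> (nat set \<Rightarrow> nat list \<Rightarrow> bool) \<Rightarrow> bool" where
  "rpred \<O> k P \<longleftrightarrow> rfun \<O> k (\<lambda>X xs. if P X xs then 1 else 0)"

lemma rfun_cong:
  "(\<And>X xs. X \<in> \<O> \<Longrightarrow> length xs = k \<Longrightarrow> f X xs = g X xs) \<Longrightarrow> rfun \<O> k f \<longleftrightarrow> rfun \<O> k g"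
  unfolding rfun_def by auto

lemma rfun_congI:
  "rfun \<O> k f \<Longrightarrow> (\<And>X xs. X \<in> \<O> \<Longrightarrow> length xs = k \<Longrightarrow> f X xs = g X xs) \<Longrightarrow> rfun \<O> k g"
  using rfun_cong[of \<O> k f g] by blast

lemma rpred_cong:
  "(\<And>X xs. X \<in> \<O> \<Longrightarrow> length xs = k \<Longrightarrow> P X xs \<longleftrightarrow> Q X xs) \<Longrightarrow> rpred \<O> k P \<longleftrightarrow> rpred \<O> k Q"
  unfolding rpred_def by (rule rfun_cong) simp

lemma rfun_compose:
  assumes "rfun \<O> m f" "length gs = m" "\<forall>g\<in>set gs. rfun \<O> k g"
  shows "rfun \<O> k (\<lambda>X xs. f X (map (\<lambda>g. g X xs) gs))"
proof -
  from assms(1) obtain c where c: "\<forall>X\<in>\<O>. \<forall>xs. length xs = m \<longrightarrow> eval X c xs (f X xs)"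
    unfolding rfun_def by blast
  from assms(3) obtain d where d: "\<forall>g\<in>set gs. \<forall>X\<in>\<O>. \<forall>xs. length xs = k \<longrightarrow> eval X (d g) xs (g X xs)"
    unfolding rfun_def by metis
  have "eval X (Comp c (map d gs)) xs (f X (map (\<lambda>g. g X xs) gs))" if "X \<in> \<O>" "length xs = k" for X xs
  proof (rule ev_comp)
    show "list_all2 (\<lambda>g y. eval X g xs y) (map d gs) (map (\<lambda>g. g X xs) gs)"
      unfolding list.rel_map using d that by (intro list.rel_refl_strong) auto
    show "eval X c (map (\<lambda>g. g X xs) gs) (f X (map (\<lambda>g. g X xs) gs))" using c that assms(2) by simp
  qed
  then show ?thesis unfolding rfun_def by blast
qed

lemma rfun_nth: "i < k \<Longrightarrow> rfun \<O> k (\<lambda>X xs. xs ! i)"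
  unfolding rfun_def by (intro exI[of _ "Proj i"]) (auto intro: ev_proj)

lemma rfun_tl1: "Suc i < k \<Longrightarrow> rfun \<O> k (\<lambda>X xs. tl xs ! i)"
  using rfun_nth[of "Suc i" k \<O>] by (rule rfun_congI) (auto simp: nth_tl)

lemma rfun_tl2: "Suc (Suc i) < k \<Longrightarrow> rfun \<O> k (\<lambda>X xs. tl (tl xs) ! i)"
  using rfun_nth[of "Suc (Suc i)" k \<O>] by (rule rfun_congI) (auto simp: nth_tl)

lemma rfun_tl3: "Suc (Suc (Suc i)) < k \<Longrightarrow> rfun \<O> k (\<lambda>X xs. tl (tl (tl xs)) ! i)"
  using rfun_nth[of "Suc (Suc (Suc i))" k \<O>] by (rule rfun_congI) (auto simp: nth_tl)

lemma rfun_app1: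
  assumes "rfun \<O> 1 (\<lambda>X xs. F X (xs ! 0))" "rfun \<O> k a"
  shows "rfun \<O> k (\<lambda>X xs. F X (a X xs))"
  using rfun_compose[OF assms(1), of "[a]" k] assms(2) by simp

lemma rfun_app2:
  assumes "rfun \<O> 2 (\<lambda>X xs. F X (xs ! 0) (xs ! 1))" "rfun \<O> k a" "rfun \<O> k b"
  shows "rfun \<O> k (\<lambda>X xs. F X (a X xs) (b X xs))"
  using rfun_compose[OF assms(1), of "[a, b]" k] assms(2-) by (simp add: numeral_2_eq_2)

lemma rfun_app3:
  assumes "rfun \<O> 3 (\<lambda>X xs. F X (xs ! 0) (xs ! 1) (xs ! 2))" "rfun \<O> k a" "rfun \<O> k b" "rfun \<O> k c"
  shows "rfun \<O> k (\<lambda>X xs. F X (a X xs) (b X xs) (c X xs))"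
  using rfun_compose[OF assms(1), of "[a, b, c]" k] assms(2-) by (simp add: numeral_3_eq_3)

lemmas rpred_app1 = rfun_app1[where F = "\<lambda>X x. if P X x then 1 else 0" for P, folded rpred_def]
lemmas rpred_app2 = rfun_app2[where F = "\<lambda>X x y. if P X x y then 1 else 0" for P, folded rpred_def]
lemmas rpred_app3 = rfun_app3[where F = "\<lambda>X x y z. if P X x y z then 1 else 0" for P, folded rpred_def]

lemma rfun_Suc: "rfun \<O> k a \<Longrightarrow> rfun \<O> k (\<lambda>X xs. Suc (a X xs))"
proof (erule rfun_app1[where F = "\<lambda>X. Suc", rotated])
  have "eval X Succ xs (Suc (xs ! 0))" if "length xs = 1" for X xs
    using that by (cases xs) (auto intro: ev_succ)
  then show "rfun \<O> 1 (\<lambda>X xs. Suc (xs ! 0))" unfolding rfun_def by auto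
qed

lemma rfun_const: "rfun \<O> k (\<lambda>X xs. c)"
proof (induction c)
  case 0
  then show ?case unfolding rfun_def by (auto intro: ev_zero)
qed (rule rfun_Suc)

text \<open>Bound variables are pushed in front of the argument list, here the counter and then the
  previous value, so the parameters sit behind two \<open>tl\<close>. All closure rules with binders
  follow this convention.\<close>

lemma rfun_rec:
  assumes f: "rfun \<O> k f"
    and g: "rfun \<O> (Suc (Suc k)) (\<lambda>X ys. g X (ys ! 0) (tl ys ! 0) (tl (tl ys)))"
    and n: "rfun \<O> k n"
  shows "rfun \<O> k (\<lambda>X xs. rec_nat (f X xs) (\<lambda>m r. g X m r xs) (n X xs))"
proof -
  obtain c where c: "\<And>X xs. X \<in> \<O> \<Longrightarrow> length xs = k \<Longrightarrow> eval X c xs (f X xs)"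
    using f unfolding rfun_def by blast
  obtain d where d: "\<And>X xs. X \<in> \<O> \<Longrightarrow> length xs = Suc (Suc k) \<Longrightarrow> eval X d xs (g X (xs ! 0) (tl xs ! 0) (tl (tl xs)))"
    using g unfolding rfun_def by blast
  have "eval X (PrimRec c d) (m # xs) (rec_nat (f X xs) (\<lambda>m r. g X m r xs) m)"
    if "X \<in> \<O>" "length xs = k" for X xs m
  proof (induction m)
    case 0
    then show ?case using c[OF that] by (auto intro: ev_prim0)
  next
    case (Suc m)
    show ?case
      using ev_primS[OF Suc d[OF that(1)]] that(2) by simp
  qed
  then have "rfun \<O> (Suc k) (\<lambda>X ys. rec_nat (f X (tl ys)) (\<lambda>m r. g X m r (tl ys)) (ys ! 0))"
    unfolding rfun_def by (intro exI[of _ "PrimRec c d"]) (auto simp: length_Suc_conv)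
  from rfun_compose[OF this, of "n # map (\<lambda>i X xs. xs ! i) [0..<k]"] n
  have "rfun \<O> k (\<lambda>X xs. rec_nat (f X (map ((!) xs) [0..<k])) (\<lambda>m r. g X m r (map ((!) xs) [0..<k])) (n X xs))"
    by (auto simp: rfun_nth comp_def)
  then show ?thesis
  proof (rule rfun_congI)
    fix X and xs :: "nat list" assume "length xs = k"
    then have "map ((!) xs) [0..<k] = xs" using map_nth by blast
    then show "rec_nat (f X (map ((!) xs) [0..<k])) (\<lambda>m r. g X m r (map ((!) xs) [0..<k])) (n X xs) =
      rec_nat (f X xs) (\<lambda>m r. g X m r xs) (n X xs)" by simp
  qed
qed

lemma rfun_if:
  assumes "rpred \<O> k P" "rfun \<O> k f" "rfun \<O> k g"
  shows "rfun \<O> k (\<lambda>X xs. if P X xs then f X xs else g X xs)"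
proof -
  \<comment> \<open>Branching is recursion on the truth value 0 or 1 that ignores the counter and
    the previous value.\<close>
  have "rfun \<O> 3 (\<lambda>X xs. rec_nat (xs ! 2) (\<lambda>_ _. xs ! 1) (xs ! 0))"
    by (intro rfun_rec rfun_nth rfun_tl2) auto
  from rfun_app3[where F = "\<lambda>X x y z. rec_nat z (\<lambda>_ _. y) x", OF this assms(1)[unfolded rpred_def] assms(2,3)]
  show ?thesis by (rule rfun_congI) auto
qed

lemma rpred_nonzero: "rfun \<O> k f \<Longrightarrow> rpred \<O> k (\<lambda>X xs. f X xs \<noteq> 0)"
proof -
  assume f: "rfun \<O> k f"
  have "rfun \<O> k (\<lambda>X xs. rec_nat 0 (\<lambda>_ _. 1) (f X xs))"
    by (intro rfun_rec rfun_const f)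
  moreover have "rec_nat 0 (\<lambda>_ _. 1) n = (if n \<noteq> 0 then 1 else 0 :: nat)" for n by (cases n) auto
  ultimately show ?thesis unfolding rpred_def by (simp only:)
qed

lemma rpred_not: "rpred \<O> k P \<Longrightarrow> rpred \<O> k (\<lambda>X xs. \<not> P X xs)"
proof -
  assume "rpred \<O> k P"
  then have "rfun \<O> k (\<lambda>X xs. if P X xs then 0 else 1)" by (intro rfun_if rfun_const)
  then show ?thesis unfolding rpred_def by (rule rfun_congI) auto
qed

lemma rpred_conj: "rpred \<O> k P \<Longrightarrow> rpred \<O> k Q \<Longrightarrow> rpred \<O> k (\<lambda>X xs. P X xs \<and> Q X xs)"
proof -
  assume P: "rpred \<O> k P" and Q: "rpred \<O> k Q"
  have "rfun \<O> k (\<lambda>X xs. if P X xs then (if Q X xs then 1 else 0) else 0)"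
    by (intro rfun_if rfun_const P Q)
  then show ?thesis unfolding rpred_def by (rule rfun_congI) auto
qed

lemma rpred_disj:
  assumes "rpred \<O> k P" "rpred \<O> k Q"
  shows "rpred \<O> k (\<lambda>X xs. P X xs \<or> Q X xs)"
proof -
  have "rpred \<O> k (\<lambda>X xs. \<not> (\<not> P X xs \<and> \<not> Q X xs))" by (intro rpred_not rpred_conj assms)
  then show ?thesis by simp
qed

lemma rpred_imp:
  assumes "rpred \<O> k P" "rpred \<O> k Q"
  shows "rpred \<O> k (\<lambda>X xs. P X xs \<longrightarrow> Q X xs)"
  unfolding imp_conv_disj by (intro rpred_disj rpred_not assms)

lemma rpred_iff:
  assumes "rpred \<O> k P" "rpred \<O> k Q"
  shows "rpred \<O> k (\<lambda>X xs. P X xs \<longleftrightarrow> Q X xs)"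
  unfolding iff_conv_conj_imp by (intro rpred_conj rpred_imp assms)

lemma rpred_const: "rpred \<O> k (\<lambda>X xs. P)"
  unfolding rpred_def by (rule rfun_const)

lemma rpred_ex:
  assumes P: "rpred \<O> (Suc k) (\<lambda>X ys. P X (ys ! 0) (tl ys))" and b: "rfun \<O> k b"
  shows "rpred \<O> k (\<lambda>X xs. \<exists>v<b X xs. P X v xs)"
proof -
  have "rfun \<O> (Suc (Suc k)) (\<lambda>X ys. if P X (ys ! 0) (tl (tl ys)) then 1 else 0)"
  proof (rule rfun_congI)
    let ?gs = "(\<lambda>X ys. ys ! 0) # map (\<lambda>i X ys. ys ! Suc (Suc i)) [0..<k]"
    show "rfun \<O> (Suc (Suc k)) (\<lambda>X xs. if P X (map (\<lambda>g. g X xs) ?gs ! 0) (tl (map (\<lambda>g. g X xs) ?gs)) then 1 else 0)"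
      by (rule rfun_compose[OF P[unfolded rpred_def]]) (auto simp: rfun_nth)
    fix xs :: "nat list" assume "length xs = Suc (Suc k)"
    then have "map (\<lambda>i. xs ! Suc (Suc i)) [0..<k] = tl (tl xs)"
      by (intro nth_equalityI) (auto simp: nth_tl)
    then show "(if P X (map (\<lambda>g. g X xs) ?gs ! 0) (tl (map (\<lambda>g. g X xs) ?gs)) then 1 else 0 :: nat) =
      (if P X (xs ! 0) (tl (tl xs)) then 1 else 0)" for X
      by (simp add: comp_def)
  qed
  then have "rfun \<O> k (\<lambda>X xs. rec_nat 0 (\<lambda>m r. if P X m xs then 1 else r) (b X xs))"
    by (intro rfun_rec rfun_if rfun_const b rfun_tl1) (auto simp: rpred_def)
  moreover have "rec_nat 0 (\<lambda>m r. if P X m xs then 1 else r) n = (if \<exists>v<n. P X v xs then 1 else 0 :: nat)" for X xs n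
    by (induction n) (auto simp: less_Suc_eq)
  ultimately show ?thesis unfolding rpred_def by simp
qed

lemma rpred_all:
  assumes "rpred \<O> (Suc k) (\<lambda>X ys. P X (ys ! 0) (tl ys))" "rfun \<O> k b"
  shows "rpred \<O> k (\<lambda>X xs. \<forall>v<b X xs. P X v xs)"
  using rpred_not[OF rpred_ex[OF rpred_not[OF assms(1)] assms(2)]] by simp

lemma rfun_Least:
  assumes P: "rpred \<O> (Suc k) (\<lambda>X ys. P X (ys ! 0) (tl ys))"
    and ex: "\<And>X xs. X \<in> \<O> \<Longrightarrow> length xs = k \<Longrightarrow> \<exists>v. P X v xs"
  shows "rfun \<O> k (\<lambda>X xs. LEAST v. P X v xs)"
proof -
  \<comment> \<open>The values are reversed: \<open>Minimize\<close> looks for 0 and needs a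
    successor value at every earlier argument.\<close>
  obtain c where c: "\<And>X ys. X \<in> \<O> \<Longrightarrow> length ys = Suc k \<Longrightarrow> eval X c ys (if P X (ys ! 0) (tl ys) then 0 else Suc 0)"
  proof -
    have "rfun \<O> (Suc k) (\<lambda>X ys. if P X (ys ! 0) (tl ys) then 0 else Suc 0)"
      by (intro rfun_if rfun_const P)
    then show thesis using that unfolding rfun_def by blast
  qed
  have "eval X (Minimize c) xs (LEAST v. P X v xs)" if "X \<in> \<O>" "length xs = k" for X xs
  proof (rule ev_min)
    have "P X (LEAST v. P X v xs) xs" using ex[OF that] by (rule LeastI_ex)
    then show "eval X c ((LEAST v. P X v xs) # xs) 0"
      using c[OF that(1), of "(LEAST v. P X v xs) # xs"] that(2) by simp
    show "\<forall>m<LEAST v. P X v xs. \<exists>k. eval X c (m # xs) (Suc k)"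
    proof (intro allI impI)
      fix m assume "m < (LEAST v. P X v xs)"
      then have "\<not> P X m xs" by (rule not_less_Least)
      then show "\<exists>k. eval X c (m # xs) (Suc k)"
        using c[OF that(1), of "m # xs"] that(2) by auto
    qed
  qed
  then show ?thesis unfolding rfun_def by blast
qed

section \<open>Arithmetic and comparisons\<close>

lemma rfun_pred: 
  assumes "rfun \<O> k a"
  shows "rfun \<O> k (\<lambda>X xs. a X xs - 1)"
proof -
  have "rfun \<O> k (\<lambda>X xs. rec_nat 0 (\<lambda>m _. m) (a X xs))"
    by (intro rfun_rec rfun_const rfun_nth assms) simp
  moreover have "rec_nat 0 (\<lambda>m _. m) n = n - 1" for n :: nat by (cases n) auto
  ultimately show ?thesis by (simp only:)
qed

lemma rfun_diff: 
  assumes "rfun \<O> k a" "rfun \<O> k b"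
  shows "rfun \<O> k (\<lambda>X xs. a X xs - b X xs)"
proof -
  have "rfun \<O> k (\<lambda>X xs. rec_nat (a X xs) (\<lambda>_ r. r - 1) (b X xs))"
    by (intro rfun_rec rfun_pred rfun_tl1 assms) simp
  moreover have "rec_nat m (\<lambda>_ r. r - 1) n = m - n" for m n :: nat by (induction n) auto
  ultimately show ?thesis by (simp only:)
qed

lemma rfun_add: 
  assumes "rfun \<O> k a" "rfun \<O> k b"
  shows "rfun \<O> k (\<lambda>X xs. a X xs + b X xs)"
proof -
  have "rfun \<O> k (\<lambda>X xs. rec_nat (a X xs) (\<lambda>_ r. Suc r) (b X xs))"
    by (intro rfun_rec rfun_Suc rfun_tl1 assms) simp
  moreover have "rec_nat m (\<lambda>_ r. Suc r) n = m + n" for m n :: nat by (induction n) auto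
  ultimately show ?thesis by (simp only:)
qed

lemma rpred_le: 
  assumes "rfun \<O> k a" "rfun \<O> k b"
  shows "rpred \<O> k (\<lambda>X xs. a X xs \<le> b X xs)"
proof -
  have "rpred \<O> k (\<lambda>X xs. \<not> a X xs - b X xs \<noteq> 0)"
    by (intro rpred_not rpred_nonzero rfun_diff assms)
  then show ?thesis by simp
qed

lemma rpred_less: 
  assumes "rfun \<O> k a" "rfun \<O> k b"
  shows "rpred \<O> k (\<lambda>X xs. a X xs < b X xs)"
  unfolding less_eq_Suc_le by (intro rpred_le rfun_Suc assms)

lemma rpred_eq: 
  assumes "rfun \<O> k a" "rfun \<O> k b"
  shows "rpred \<O> k (\<lambda>X xs. a X xs = b X xs)"
  unfolding order_eq_iff by (intro rpred_conj rpred_le assms)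

section \<open>Argument lists with recursive entries\<close>

definition rlist :: "nat set set \<Rightarrow> nat \<Rightarrow> nat \<Rightarrow> (nat set \<Rightarrow> nat list \<Rightarrow> nat list) \<Rightarrow> bool" where
  "rlist \<O> k m E \<longleftrightarrow> (\<exists>gs. length gs = m \<and> (\<forall>g\<in>set gs. rfun \<O> k g) \<and>
     (\<forall>X\<in>\<O>. \<forall>xs. length xs = k \<longrightarrow> E X xs = map (\<lambda>g. g X xs) gs))"

lemma rlist_Nil: "rlist \<O> k 0 (\<lambda>X xs. [])"
  unfolding rlist_def by (intro exI[of _ "[]"]) simp

lemma rlist_Cons:
  assumes a: "rfun \<O> k a" and "rlist \<O> k m E"
  shows "rlist \<O> k (Suc m) (\<lambda>X xs. a X xs # E X xs)"
proof -
  from assms(2) obtain gs where "length gs = m \<and> (\<forall>g\<in>set gs. rfun \<O> k g) \<and>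
     (\<forall>X\<in>\<O>. \<forall>xs. length xs = k \<longrightarrow> E X xs = map (\<lambda>g. g X xs) gs)" unfolding rlist_def by blast
  then show ?thesis using a unfolding rlist_def by (intro exI[of _ "a # gs"]) simp
qed

lemma rlist_map: "(\<And>g. g \<in> set gs \<Longrightarrow> rfun \<O> k (F g)) \<Longrightarrow> rlist \<O> k (length gs) (\<lambda>X xs. map (\<lambda>g. F g X xs) gs)"
  unfolding rlist_def by (intro exI[of _ "map F gs"]) auto

lemma rlist_drop: "rlist \<O> (j + m) m (\<lambda>X xs. drop j xs)"
  unfolding rlist_def
proof (intro exI[of _ "map (\<lambda>i X xs. xs ! (j + i)) [0..<m]"] conjI ballI allI impI)
  fix xs :: "nat list" assume "length xs = j + m"
  then show "drop j xs = map (\<lambda>g. g X xs) (map (\<lambda>i X xs. xs ! (j + i)) [0..<m])" for X :: "nat set"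
    by (intro nth_equalityI) auto
qed (auto simp: rfun_nth)

text \<open>One case for each number of entries in front of the parameters. Five occur for
  \<open>PrimRec\<close> in \<open>rfun_eval_upto\<close>: counter, previous value, time bound,
  oracle code and recursion argument.\<close>

lemma rlist_tl:
  "rlist \<O> k k (\<lambda>X xs. xs)"
  "rlist \<O> (Suc k) k (\<lambda>X xs. tl xs)"
  "rlist \<O> (Suc (Suc k)) k (\<lambda>X xs. tl (tl xs))"
  "rlist \<O> (Suc (Suc (Suc k))) k (\<lambda>X xs. tl (tl (tl xs)))"
  "rlist \<O> (Suc (Suc (Suc (Suc k)))) k (\<lambda>X xs. tl (tl (tl (tl xs))))"
  "rlist \<O> (Suc (Suc (Suc (Suc (Suc k))))) k (\<lambda>X xs. tl (tl (tl (tl (tl xs)))))"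
  using rlist_drop[of \<O> 0 k] rlist_drop[of \<O> 1 k] rlist_drop[of \<O> 2 k]
    rlist_drop[of \<O> 3 k] rlist_drop[of \<O> 4 k] rlist_drop[of \<O> 5 k]
  by (simp_all add: drop_Suc eval_nat_numeral)

lemma rfun_env:
  assumes "rfun \<O> m f" "rlist \<O> k m E"
  shows "rfun \<O> k (\<lambda>X xs. f X (E X xs))"
proof -
  from assms(2) obtain gs where gs: "length gs = m" "\<forall>g\<in>set gs. rfun \<O> k g"
     and E: "\<And>X xs. X\<in>\<O> \<Longrightarrow> length xs = k \<Longrightarrow> E X xs = map (\<lambda>g. g X xs) gs" unfolding rlist_def by blast
  show ?thesis by (rule rfun_congI[OF rfun_compose[OF assms(1) gs]]) (simp add: E)
qed

lemma rpred_env: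
  assumes "rpred \<O> m P" "rlist \<O> k m E"
  shows "rpred \<O> k (\<lambda>X xs. P X (E X xs))"
  using assms unfolding rpred_def by (rule rfun_env)

lemma rpred_ball:
  assumes "finite S" "\<And>s. s \<in> S \<Longrightarrow> rpred \<O> k (P s)"
  shows "rpred \<O> k (\<lambda>X xs. \<forall>s\<in>S. P s X xs)"
  using assms
proof (induction S)
  case (insert s S)
  then have "rpred \<O> k (\<lambda>X xs. P s X xs \<and> (\<forall>s\<in>S. P s X xs))" by (intro rpred_conj) auto
  then show ?case by simp
qed (simp add: rpred_const)

section \<open>Finite sets coded in binary\<close>

lemma rfun_pow2: 
  assumes "rfun \<O> k a"
  shows "rfun \<O> k (\<lambda>X xs. 2 ^ a X xs)"
proof -
  have "rfun \<O> k (\<lambda>X xs. rec_nat 1 (\<lambda>_ r. r + r) (a X xs))"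
    by (intro rfun_rec rfun_add rfun_const rfun_tl1 assms) simp_all
  moreover have "rec_nat 1 (\<lambda>_ r. r + r) n = (2 ^ n :: nat)" for n by (induction n) auto
  ultimately show ?thesis by (simp only:)
qed

lemma rfun_mult: 
  assumes "rfun \<O> k a" "rfun \<O> k b"
  shows "rfun \<O> k (\<lambda>X xs. a X xs * b X xs)"
proof -
  have "rfun \<O> k (\<lambda>X xs. rec_nat 0 (\<lambda>_ r. r + a X xs) (b X xs))"
    by (intro rfun_rec rfun_add rfun_const rfun_tl1 rfun_env[OF assms(1)] rlist_tl assms) simp
  moreover have "rec_nat 0 (\<lambda>_ r. r + m) n = m * n" for m n :: nat by (induction n) auto
  ultimately show ?thesis by (simp only:)
qed

text \<open>Division is avoided: bit \<open>x\<close> of \<open>a\<close> is read off by a bounded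
  search for the remainder \<open>r\<close> and for half of the odd quotient.\<close>

lemma mem_set_decode_iff: "x \<in> set_decode a \<longleftrightarrow> (\<exists>q<Suc a. \<exists>r<2 ^ x. a = Suc (q + q) * 2 ^ x + r)"
proof
  assume "x \<in> set_decode a"
  then have "odd (a div 2 ^ x)" by (simp add: set_decode_def)
  then obtain q where q: "a div 2 ^ x = Suc (q + q)" by (metis oddE mult_2 Suc_eq_plus1)
  then have "a = Suc (q + q) * 2 ^ x + a mod 2 ^ x" by (metis div_mult_mod_eq)
  moreover have "q < Suc a" using q by (metis div_le_dividend le_add1 le_imp_less_Suc le_trans Suc_leD)
  ultimately show "\<exists>q<Suc a. \<exists>r<2 ^ x. a = Suc (q + q) * 2 ^ x + r" by (metis mod_less_divisor zero_less_numeral zero_less_power)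
next
  assume "\<exists>q<Suc a. \<exists>r<2 ^ x. a = Suc (q + q) * 2 ^ x + r"
  then obtain q r where "r < 2 ^ x" "a = Suc (q + q) * 2 ^ x + r" by blast
  then have "a div 2 ^ x = Suc (q + q)" by (intro div_nat_eqI) auto
  then show "x \<in> set_decode a" by (simp add: set_decode_def)
qed

lemma rpred_mem_decode:
  assumes "rfun \<O> k a" "rfun \<O> k b"
  shows "rpred \<O> k (\<lambda>X xs. a X xs \<in> set_decode (b X xs))"
proof -
  have "rpred \<O> 2 (\<lambda>X xs. \<exists>q<Suc (xs ! 1). \<exists>r<2 ^ (xs ! 0). xs ! 1 = Suc (q + q) * 2 ^ (xs ! 0) + r)"
    by (intro rpred_ex rpred_eq rfun_pow2 rfun_add rfun_mult rfun_Suc rfun_nth rfun_tl1 rfun_tl2) simp_all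
  then have "rpred \<O> 2 (\<lambda>X xs. xs ! 0 \<in> set_decode (xs ! 1))"
    by (simp only: mem_set_decode_iff)
  from rpred_app2[where P = "\<lambda>X x y. x \<in> set_decode y", OF this assms] show ?thesis .
qed

lemma rpred_mem_oracle:
  assumes "rfun \<O> k a"
  shows "rpred \<O> k (\<lambda>X xs. a X xs \<in> X)"
proof (rule rpred_app1[where P = "\<lambda>X x. x \<in> X", OF _ assms])
  have "eval X Orc xs (if xs ! 0 \<in> X then 1 else 0)" if "length xs = 1" for X xs
    using that ev_orc[of X "hd xs" "tl xs"] by (cases xs) auto
  then show "rpred \<O> 1 (\<lambda>X xs. xs ! 0 \<in> X)"
    unfolding rpred_def rfun_def by blast
qed

lemma rfun_bounded_Least:
  assumes P: "rpred \<O> (Suc k) (\<lambda>X ys. P X (ys ! 0) (tl ys))" and b: "rfun \<O> k b"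
  shows "rfun \<O> k (\<lambda>X xs. if \<exists>v<b X xs. P X v xs then Suc (LEAST v. P X v xs) else 0)"
proof -
  \<comment> \<open>The disjunct \<open>b X xs \<le> v\<close> makes the search total; it does not
    change the minimum when there is a witness below the bound.\<close>
  have "rfun \<O> k (\<lambda>X xs. LEAST v. b X xs \<le> v \<or> P X v xs)"
    by (rule rfun_Least) (intro rpred_disj rpred_le rfun_env[OF b] rlist_tl rfun_nth P, auto)
  then have "rfun \<O> k (\<lambda>X xs. if \<exists>v<b X xs. P X v xs then Suc (LEAST v. b X xs \<le> v \<or> P X v xs) else 0)"
    by (intro rfun_if rpred_ex rfun_Suc rfun_const P b)
  moreover have "(LEAST v. b X xs \<le> v \<or> P X v xs) = (LEAST v. P X v xs)" if "v < b X xs" "P X v xs" for v X xs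
  proof -
    have L: "P X (LEAST v. P X v xs) xs" "(LEAST v. P X v xs) \<le> v" using that by (auto intro: LeastI Least_le)
    then show ?thesis using that by (intro Least_equality) (auto intro: Least_le)
  qed
  ultimately show ?thesis by (elim rfun_congI) auto
qed

section \<open>Recursiveness of bounded evaluation\<close>

definition ocode :: "nat option \<Rightarrow> nat" where
  "ocode r = (case r of None \<Rightarrow> 0 | Some y \<Rightarrow> Suc y)"

lemma ocode_simps [simp]: "ocode None = 0" "ocode (Some y) = Suc y" "ocode r = 0 \<longleftrightarrow> r = None"
  by (auto simp: ocode_def split: option.splits)

lemma ocode_if [simp]: "ocode (if b then x else y) = (if b then ocode x else ocode y)"
  by simp

lemma the_eq_ocode: "r \<noteq> None \<Longrightarrow> the r = ocode r - 1"
  by (auto simp: ocode_def)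

text \<open>The oracle of the simulated code is a coded finite set passed as an argument, not the
  ambient oracle, because stems and tree nodes are finite sets on which a code has to be run. Time,
  oracle and arguments are arbitrary recursive expressions so that the induction hypothesis applies
  under binders.\<close>

lemma rfun_eval_upto:
  assumes "rfun \<O> k a" "rfun \<O> k h" "rlist \<O> k m E"
  shows "rfun \<O> k (\<lambda>X xs. ocode (eval_upto (a X xs) (set_decode (h X xs)) e (E X xs)))"
  using assms
proof (induction e arbitrary: k m a h E)
  case Zero
  then show ?case by (simp add: rfun_const)
next
  case Succ
  have "rfun \<O> m (\<lambda>X xs. ocode (case xs of [] \<Rightarrow> None | x # _ \<Rightarrow> Some (Suc x)))"
  proof (cases m)
    case 0
    then show ?thesis by (intro rfun_congI[OF rfun_const[of _ _ 0]]) auto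
  next
    case (Suc n)
    then have "rfun \<O> m (\<lambda>X xs. Suc (Suc (xs ! 0)))" by (intro rfun_Suc rfun_nth) simp
    then show ?thesis by (rule rfun_congI) (auto simp: Suc length_Suc_conv)
  qed
  from rfun_env[OF this Succ(3)] show ?case by simp
next
  case (Proj i)
  have "rfun \<O> m (\<lambda>X xs. ocode (if i < length xs then Some (xs ! i) else None))"
  proof (cases "i < m")
    case False
    then show ?thesis by (intro rfun_congI[OF rfun_const[of _ _ 0]]) auto
  next
    case True
    then have "rfun \<O> m (\<lambda>X xs. Suc (xs ! i))" by (intro rfun_Suc rfun_nth)
    then show ?thesis by (rule rfun_congI) (auto simp: True)
  qed
  from rfun_env[OF this Proj(3)] show ?case by simp
next
  case (Comp f gs)
  let ?v = "\<lambda>g X xs. ocode (eval_upto (a X xs) (set_decode (h X xs)) g (E X xs))"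
  have v: "rfun \<O> k (?v g)" if "g \<in> set gs" for g
    using Comp.IH(2)[OF that Comp.prems] .
  have "rfun \<O> k (\<lambda>X xs. if \<forall>g\<in>set gs. ?v g X xs \<noteq> 0
      then ocode (eval_upto (a X xs) (set_decode (h X xs)) f (map (\<lambda>g. ?v g X xs - 1) gs)) else 0)"
    by (intro rfun_if rpred_ball rpred_nonzero v Comp.IH(1)[OF Comp.prems(1,2) rlist_map] rfun_pred rfun_const finite_set)
  then show ?case
  proof (rule rfun_congI)
    fix X xs
    show "(if \<forall>g\<in>set gs. ?v g X xs \<noteq> 0
      then ocode (eval_upto (a X xs) (set_decode (h X xs)) f (map (\<lambda>g. ?v g X xs - 1) gs)) else 0) =
      ocode (eval_upto (a X xs) (set_decode (h X xs)) (Comp f gs) (E X xs))"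
    proof (cases "\<forall>g\<in>set gs. ?v g X xs \<noteq> 0")
      case True
      then have "map (\<lambda>g. ?v g X xs - 1) gs = map (\<lambda>g. the (eval_upto (a X xs) (set_decode (h X xs)) g (E X xs))) gs"
        by (auto simp: the_eq_ocode)
      then show ?thesis using True by (auto simp del: map_eq_conv)
    qed auto
  qed
next
  case (PrimRec f g)
  show ?case
  proof (cases m)
    case 0
    then have "E X xs = []" if "X \<in> \<O>" "length xs = k" for X xs
      using PrimRec.prems(3) that unfolding rlist_def by auto
    then show ?thesis by (intro rfun_congI[OF rfun_const[of _ _ 0]]) auto
  next
    case (Suc n)
    have "rfun \<O> (Suc (Suc m)) (\<lambda>X xs. rec_nat (ocode (eval_upto (xs ! 0) (set_decode (xs ! 1)) f (tl (tl (tl xs)))))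
       (\<lambda>i r. if r \<noteq> 0 then ocode (eval_upto (xs ! 0) (set_decode (xs ! 1)) g (i # (r - 1) # tl (tl (tl xs)))) else 0) (xs ! 2))"
    proof (rule rfun_rec)
      have l: "rlist \<O> (Suc (Suc m)) n (\<lambda>X xs. tl (tl (tl xs)))" unfolding Suc by (rule rlist_tl)
      have l': "rlist \<O> (Suc (Suc (Suc (Suc m)))) (Suc (Suc n)) (\<lambda>X xs. xs ! 0 # (tl xs ! 0 - 1) # tl (tl (tl (tl (tl xs)))))"
        unfolding Suc by (intro rlist_Cons rlist_tl rfun_pred rfun_nth rfun_tl1) simp_all
      show "rfun \<O> (Suc (Suc m)) (\<lambda>X xs. ocode (eval_upto (xs ! 0) (set_decode (xs ! 1)) f (tl (tl (tl xs)))))"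
        by (intro PrimRec.IH(1)[OF _ _ l] rfun_nth) simp_all
      show "rfun \<O> (Suc (Suc (Suc (Suc m)))) (\<lambda>X ys. if tl ys ! 0 \<noteq> 0 then
          ocode (eval_upto (tl (tl ys) ! 0) (set_decode (tl (tl ys) ! 1)) g (ys ! 0 # (tl ys ! 0 - 1) # tl (tl (tl (tl (tl ys)))))) else 0)"
        by (intro rfun_if rpred_nonzero rfun_const PrimRec.IH(2)[OF _ _ l'] rfun_tl1 rfun_tl2) simp_all
      show "rfun \<O> (Suc (Suc m)) (\<lambda>X xs. xs ! 2)" using Suc by (intro rfun_nth) simp
    qed
    moreover have "rec_nat (ocode (eval_upto t H f xs))
       (\<lambda>i r. if r \<noteq> 0 then ocode (eval_upto t H g (i # (r - 1) # xs)) else 0) i =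
      ocode (eval_upto t H (PrimRec f g) (i # xs))" for t H xs i
      by (induction i) (auto split: option.splits)
    ultimately have "rfun \<O> (Suc (Suc m)) (\<lambda>X xs. ocode (eval_upto (xs ! 0) (set_decode (xs ! 1)) (PrimRec f g) (xs ! 2 # tl (tl (tl xs)))))"
      by (simp only:)
    from rfun_env[OF this rlist_Cons[OF PrimRec.prems(1) rlist_Cons[OF PrimRec.prems(2,3)]]]
    show ?thesis
    proof (rule rfun_congI)
      fix X and xs :: "nat list" assume "X \<in> \<O>" "length xs = k"
      then obtain y ys where "E X xs = y # ys"
        using PrimRec.prems(3) Suc unfolding rlist_def by (fastforce simp: length_Suc_conv)
      then show "ocode (eval_upto ((a X xs # h X xs # E X xs) ! 0) (set_decode ((a X xs # h X xs # E X xs) ! 1)) (PrimRec f g)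
         ((a X xs # h X xs # E X xs) ! 2 # tl (tl (tl (a X xs # h X xs # E X xs))))) =
        ocode (eval_upto (a X xs) (set_decode (h X xs)) (PrimRec f g) (E X xs))"
        by simp
    qed
  qed
next
  case (Minimize f)
  have "rfun \<O> (Suc (Suc m)) (\<lambda>X xs.
      if \<exists>v<xs ! 0. ocode (eval_upto (xs ! 0) (set_decode (xs ! 1)) f (v # tl (tl xs))) = 1 \<and>
        (\<forall>i<v. 2 \<le> ocode (eval_upto (xs ! 0) (set_decode (xs ! 1)) f (i # tl (tl xs))))
      then Suc (LEAST v. ocode (eval_upto (xs ! 0) (set_decode (xs ! 1)) f (v # tl (tl xs))) = 1 \<and>
        (\<forall>i<v. 2 \<le> ocode (eval_upto (xs ! 0) (set_decode (xs ! 1)) f (i # tl (tl xs))))) else 0)"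
    by (intro rfun_bounded_Least rpred_conj rpred_eq rpred_all rpred_le rfun_const rfun_nth rfun_tl1 rfun_tl2
        Minimize.IH[OF _ _ rlist_Cons[OF rfun_nth rlist_tl(4)]] Minimize.IH[OF _ _ rlist_Cons[OF rfun_nth rlist_tl(5)]]) simp_all
  moreover have "ocode r = 1 \<longleftrightarrow> r = Some 0" "2 \<le> ocode r \<longleftrightarrow> (\<exists>k. r = Some (Suc k))" for r
    by (auto simp: ocode_def numeral_2_eq_2 Suc_le_eq gr0_conv_Suc split: option.splits)
  ultimately have "rfun \<O> (Suc (Suc m)) (\<lambda>X xs. ocode (eval_upto (xs ! 0) (set_decode (xs ! 1)) (Minimize f) (tl (tl xs))))"
    by (simp only: eval_upto.simps ocode_if ocode_simps)
  from rfun_env[OF this rlist_Cons[OF Minimize.prems(1) rlist_Cons[OF Minimize.prems(2,3)]]]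
  show ?case by simp
next
  case Orc
  have "rfun \<O> (Suc (Suc m)) (\<lambda>X xs. ocode (case tl (tl xs) of [] \<Rightarrow> None | x # _ \<Rightarrow>
     if x < xs ! 0 then Some (if x \<in> set_decode (xs ! 1) then 1 else 0) else None))"
  proof (cases m)
    case 0
    then show ?thesis by (intro rfun_congI[OF rfun_const[of _ _ 0]]) (auto simp: length_Suc_conv)
  next
    case (Suc n)
    then have "rfun \<O> (Suc (Suc m)) (\<lambda>X xs. if xs ! 2 < xs ! 0 then Suc (if xs ! 2 \<in> set_decode (xs ! 1) then 1 else 0) else 0)"
      by (intro rfun_if rpred_less rfun_Suc rfun_nth rfun_const rpred_mem_decode) auto
    then show ?thesis by (rule rfun_congI) (auto simp: Suc length_Suc_conv)
  qed
  from rfun_env[OF this rlist_Cons[OF Orc(1) rlist_Cons[OF Orc(2,3)]]]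
  show ?case by (rule rfun_congI) (simp split: list.split)
qed

lemma rpred_halts:
  assumes "rfun \<O> k a" "rfun \<O> k h" "rfun \<O> k b"
  shows "rpred \<O> k (\<lambda>X xs. eval_upto (a X xs) (set_decode (h X xs)) e [b X xs] \<noteq> None)"
  using rpred_nonzero[OF rfun_eval_upto[OF assms(1,2) rlist_Cons[OF assms(3) rlist_Nil]]] by simp

text \<open>\<open>Comp Zero [Proj 0]\<close> rather than \<open>Zero\<close>, because \<open>Orc\<close> diverges on the empty argument list.\<close>

fun erase_oracle :: "recf \<Rightarrow> recf" where
  "erase_oracle (Comp f gs) = Comp (erase_oracle f) (map erase_oracle gs)"
| "erase_oracle (PrimRec f g) = PrimRec (erase_oracle f) (erase_oracle g)"
| "erase_oracle (Minimize f) = Minimize (erase_oracle f)"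
| "erase_oracle Orc = Comp Zero [Proj 0]"
| "erase_oracle f = f"

lemma eval_erase_oracle: "eval {} f xs y \<Longrightarrow> eval X (erase_oracle f) xs y"
proof (induction rule: eval.induct)
  case (ev_comp xs gs ys f z)
  then show ?case
    by (auto intro!: eval.ev_comp simp: list.rel_map elim!: list_all2_mono)
next
  case (ev_orc x xs)
  have "eval X (Comp Zero [Proj 0]) (x # xs) 0"
    by (rule eval.ev_comp[where ys = "[x]"]) (use ev_proj[of 0 "x # xs" X] in \<open>auto intro: eval.intros\<close>)
  then show ?case by simp
next
  case (ev_min f n xs)
  then show ?case by (auto intro!: eval.ev_min)
qed (auto intro: eval.intros)

section \<open>Passage to and from \<open>rel_computable\<close> and \<open>computes\<close>\<close>

lemma rpred_of_rel_computable:
  assumes r: "rel_computable {} r" and ab: "rfun \<O> k a" "rfun \<O> k b"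
  shows "rpred \<O> k (\<lambda>X xs. (a X xs, b X xs) \<in> r)"
proof (rule rpred_app2[where P = "\<lambda>X x y. (x, y) \<in> r", OF _ ab])
  obtain f where f: "\<And>m n. eval {} f [m, n] (if (m, n) \<in> r then 1 else 0)"
    using r unfolding rel_computable_def by blast
  have "eval X (erase_oracle f) xs (if (xs ! 0, xs ! 1) \<in> r then 1 else 0)" if "length xs = 2" for X xs
  proof -
    have "length xs = Suc (Suc 0)" using that by simp
    then obtain m n where "xs = [m, n]" by (auto simp: length_Suc_conv)
    then show ?thesis using eval_erase_oracle[OF f] by simp
  qed
  then show "rpred \<O> 2 (\<lambda>X xs. (xs ! 0, xs ! 1) \<in> r)" unfolding rpred_def rfun_def by blast
qed

lemma rel_computableI:
  assumes "rpred {X} 2 (\<lambda>X xs. (xs ! 0, xs ! 1) \<in> r)"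
  shows "rel_computable X r"
proof -
  obtain c where c: "\<And>xs. length xs = 2 \<Longrightarrow> eval X c xs (if (xs ! 0, xs ! 1) \<in> r then 1 else 0)"
    using assms unfolding rpred_def rfun_def by blast
  have "eval X c [m, n] (if (m, n) \<in> r then 1 else 0)" for m n using c[of "[m, n]"] by simp
  then show ?thesis unfolding rel_computable_def by blast
qed

lemma computes_uniformlyI:
  assumes "rpred \<O> 1 (\<lambda>X xs. xs ! 0 \<in> A)"
  shows "\<exists>Phi. \<forall>S\<in>\<O>. computes S Phi A"
proof -
  obtain c where c: "\<And>X xs. X \<in> \<O> \<Longrightarrow> length xs = 1 \<Longrightarrow> eval X c xs (if xs ! 0 \<in> A then 1 else 0)"
    using assms unfolding rpred_def rfun_def by blast
  have "eval S c [n] (if n \<in> A then 1 else 0)" if "S \<in> \<O>" for S n using c[OF that, of "[n]"] by simp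
  then show ?thesis unfolding computes_def by blast
qed

section \<open>Forcing a uniform enumeration\<close>

lemma interval_Int_Suc: "S \<inter> {p..<Suc x} = (if x \<in> S \<and> p \<le> x then insert x (S \<inter> {p..<x}) else S \<inter> {p..<x})"
  for S :: "nat set"
  by (auto simp: less_Suc_eq)

text \<open>A triple \<open>(e, F, n)\<close> promises that no extension of the stem \<open>F\<close> into the reservoir makes index
  \<open>e\<close> accept \<open>n\<close>. All finite subsets \<open>H\<close> count, not just initial segments.\<close>

definition avoids :: "('e \<Rightarrow> nat \<Rightarrow> nat set \<Rightarrow> bool) \<Rightarrow> ('e \<times> nat set \<times> nat) set \<Rightarrow> nat set \<Rightarrow> bool" where
  "avoids Cv Q Y \<longleftrightarrow> (\<forall>(e, F, n)\<in>Q. \<forall>H. finite H \<and> H \<subseteq> Y \<longrightarrow> \<not> Cv e n (F \<union> H))"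

lemma avoidsD: "avoids Cv Q Y \<Longrightarrow> (e, F, n) \<in> Q \<Longrightarrow> finite H \<Longrightarrow> H \<subseteq> Y \<Longrightarrow> \<not> Cv e n (F \<union> H)"
  unfolding avoids_def by fast

text \<open>Only \<open>B\<close>, the stem and the promises restrict \<open>Y\<close>; no earlier
  reservoir is mentioned. For a finite \<open>Q\<close> this can be tested from \<open>B\<close> on
  finite subsets of \<open>Y\<close>.\<close>

definition reservoir ::
  "('e \<Rightarrow> nat \<Rightarrow> nat set \<Rightarrow> bool) \<Rightarrow> nat set \<Rightarrow> nat set \<Rightarrow> ('e \<times> nat set \<times> nat) set \<Rightarrow> nat set \<Rightarrow> bool" where
  "reservoir Cv B F Q Y \<longleftrightarrow> infinite Y \<and> Y \<subseteq> B \<and> (\<forall>x\<in>F. \<forall>y\<in>Y. x < y) \<and> avoids Cv Q Y"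

text \<open>When \<open>D\<close> moves from the reservoir into the stem, a promise has to be kept
  for every way of using only some elements of \<open>D\<close>, so each promise splits into one for
  each subset of \<open>D\<close>.\<close>

definition shift_stems :: "nat set \<Rightarrow> ('e \<times> nat set \<times> nat) set \<Rightarrow> ('e \<times> nat set \<times> nat) set" where
  "shift_stems D Q = (\<Union>(e, F, n)\<in>Q. (\<lambda>H. (e, F \<union> H, n)) ` Pow D)"

lemma shift_stemsI: "(e, F, n) \<in> Q \<Longrightarrow> H \<subseteq> D \<Longrightarrow> (e, F \<union> H, n) \<in> shift_stems D Q"
  unfolding shift_stems_def by (rule UN_I[of "(e, F, n)"]) simp_all

lemma shift_stemsE:
  assumes "(e, F', n) \<in> shift_stems D Q"
  obtains F H where "(e, F, n) \<in> Q" "H \<subseteq> D" "F' = F \<union> H"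
proof -
  obtain z where z: "z \<in> Q" "(e, F', n) \<in> (case z of (e, F, n) \<Rightarrow> (\<lambda>H. (e, F \<union> H, n)) ` Pow D)"
    using assms unfolding shift_stems_def by (rule UN_E)
  obtain e' F n' where "z = (e', F, n')" by (cases z)
  then show thesis using z that by auto
qed

lemma finite_shift_stems:
  assumes Q: "finite Q" "\<forall>(e, F, n)\<in>Q. finite F" and D: "finite D"
  shows "finite (shift_stems D Q)" "\<forall>(e, F, n)\<in>shift_stems D Q. finite F"
proof -
  have "finite (case z of (e, F, n) \<Rightarrow> (\<lambda>H. (e, F \<union> H, n)) ` Pow D)" for z :: "'e \<times> nat set \<times> nat"
    using D by (cases z) simp
  then show "finite (shift_stems D Q)" unfolding shift_stems_def by (intro finite_UN_I Q(1))
  have "finite F'" if "(e, F', n) \<in> shift_stems D Q" for e F' n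
    using that
  proof (rule shift_stemsE)
    fix F H assume F: "(e, F, n) \<in> Q" "H \<subseteq> D" "F' = F \<union> H"
    have "finite F" using Q(2) F(1) by fast
    then show ?thesis using F(3) finite_subset[OF F(2) D] by simp
  qed
  then show "\<forall>(e, F, n)\<in>shift_stems D Q. finite F" by blast
qed

text \<open>The last clause hands every promise down to all larger stems, whichever of the new
  elements are used; it is what refutes an acceptance by the limit of the stems.\<close>

fun extends :: "nat set \<times> ('e \<times> nat set \<times> nat) set \<Rightarrow> nat set \<times> ('e \<times> nat set \<times> nat) set \<Rightarrow> bool" where
  "extends (F, Q) (F', Q') \<longleftrightarrow> F \<subseteq> F' \<and> (\<forall>x\<in>F. \<forall>y\<in>F' - F. x < y) \<and>
     (\<forall>e F0 n H. (e, F0, n) \<in> Q \<longrightarrow> H \<subseteq> F' - F \<longrightarrow> (e, F0 \<union> H, n) \<in> Q')"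

lemma extendsD: "extends (F, Q) (F', Q') \<Longrightarrow> (e, F0, n) \<in> Q \<Longrightarrow> H \<subseteq> F' - F \<Longrightarrow> (e, F0 \<union> H, n) \<in> Q'"
  by simp

lemma extends_refl: "extends s s"
  by (cases s) auto

lemma extends_trans:
  assumes "extends s s'" "extends s' s''"
  shows "extends s s''"
proof -
  obtain F Q F' Q' F'' Q'' where s: "s = (F, Q)" "s' = (F', Q')" "s'' = (F'', Q'')"
    by (metis surj_pair)
  have "(e, F0 \<union> H, n) \<in> Q''" if "(e, F0, n) \<in> Q" "H \<subseteq> F'' - F" for e F0 n H
  proof -
    have "H \<inter> F' \<subseteq> F' - F" "H - F' \<subseteq> F'' - F'" using that by blast+
    then have "(e, (F0 \<union> (H \<inter> F')) \<union> (H - F'), n) \<in> Q''"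
      using extendsD[OF assms(2)[unfolded s] extendsD[OF assms(1)[unfolded s] that(1)]] by blast
    moreover have "(F0 \<union> (H \<inter> F')) \<union> (H - F') = F0 \<union> H" by blast
    ultimately show ?thesis by simp
  qed
  moreover have "\<forall>x\<in>F. \<forall>y\<in>F'' - F. x < y" using assms unfolding s by auto blast+
  ultimately show ?thesis using assms unfolding s by auto
qed

text \<open>The extra element \<open>x\<close> makes the stem grow even for \<open>H = {}\<close>,
  so that the limit of the stems becomes infinite.\<close>

lemma extend_condition:
  assumes X: "reservoir Cv B F Q X" and H: "H \<subseteq> X" "finite H"
  obtains x where "x \<in> X" "\<forall>h\<in>H. h < x" "extends (F, Q) (F \<union> insert x H, shift_stems (insert x H) Q)"
    "reservoir Cv B (F \<union> insert x H) (shift_stems (insert x H) Q) (X \<inter> {x<..})"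
proof -
  have inf: "infinite X" using X unfolding reservoir_def by blast
  then obtain x where x: "x \<in> X" "Max (insert 0 H) < x" by (meson infinite_nat_iff_unbounded)
  then have Hx: "\<forall>h\<in>H. h < x" using H(2) by (auto intro: le_less_trans[OF Max_ge])
  let ?D = "insert x H"
  have "extends (F, Q) (F \<union> ?D, shift_stems ?D Q)"
  proof -
    have "\<forall>z\<in>F. \<forall>y\<in>?D. z < y" using X H(1) x(1) unfolding reservoir_def by blast
    moreover have "(e, F0 \<union> K, n) \<in> shift_stems ?D Q" if "(e, F0, n) \<in> Q" "K \<subseteq> F \<union> ?D - F" for e F0 n K
      by (rule shift_stemsI[OF that(1)]) (use that(2) in blast)
    ultimately show ?thesis by auto
  qed
  moreover have "reservoir Cv B (F \<union> ?D) (shift_stems ?D Q) (X \<inter> {x<..})"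
    unfolding reservoir_def
  proof (intro conjI)
    have "X = (X \<inter> {x<..}) \<union> (X \<inter> {..x})" by auto
    then show "infinite (X \<inter> {x<..})" using inf by (metis finite_Un finite_Int finite_atMost)
    show "X \<inter> {x<..} \<subseteq> B" using X unfolding reservoir_def by blast
    show "\<forall>z\<in>F \<union> ?D. \<forall>y\<in>X \<inter> {x<..}. z < y" using X Hx unfolding reservoir_def by fastforce
    have av: "avoids Cv Q X" using X unfolding reservoir_def by blast
    show "avoids Cv (shift_stems ?D Q) (X \<inter> {x<..})"
      unfolding avoids_def
    proof (clarify)
      fix e F1 n K assume m: "(e, F1, n) \<in> shift_stems ?D Q" and K: "finite K" "K \<subseteq> X \<inter> {x<..}" "Cv e n (F1 \<union> K)"
      from m obtain F0 H' where F0: "(e, F0, n) \<in> Q" "H' \<subseteq> ?D" "F1 = F0 \<union> H'" by (rule shift_stemsE)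
      have "finite H'" using finite_subset[OF F0(2)] H(2) by simp
      then have "finite (H' \<union> K)" using K(1) by simp
      moreover have "H' \<union> K \<subseteq> X" using F0(2) K(2) H(1) x(1) by blast
      ultimately have "\<not> Cv e n (F0 \<union> (H' \<union> K))" by (rule avoidsD[OF av F0(1)])
      then show False using K(3) F0(3) by (simp add: Un_assoc)
    qed
  qed
  ultimately show thesis using that x(1) Hx by blast
qed

text \<open>The index \<open>e\<close> is diagonalised: either it already accepts a wrong number on
  the initial segment \<open>K\<close>, or it is promised never to accept some member of
  \<open>A\<close> beyond \<open>K\<close>.\<close>

definition decides :: "nat set \<Rightarrow> ('e \<Rightarrow> nat \<Rightarrow> nat set \<Rightarrow> bool) \<Rightarrow> 'e \<Rightarrow> nat set \<Rightarrow> ('e \<times> nat set \<times> nat) set \<Rightarrow> bool" where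
  "decides A Cv e F Q \<longleftrightarrow> (\<exists>K\<subseteq>F. (\<forall>x\<in>K. \<forall>y\<in>F - K. x < y) \<and>
     ((\<exists>n. n \<notin> A \<and> Cv e n K) \<or> (\<exists>n\<in>A. \<forall>H\<subseteq>F - K. (e, K \<union> H, n) \<in> Q)))"

text \<open>If every condition and every index failed, the indices could be diagonalised one after
  another, and the union \<open>G\<close> of the stems would be an infinite subset of
  \<open>B\<close> on which no index enumerates \<open>A\<close>. When completeness fails, the
  offending \<open>Y\<close> becomes the new reservoir although it need not lie in \<open>X\<close>;
  this freedom makes it possible to conclude completeness for all compatible
  \<open>Y\<close>.\<close>

lemma uniform_on_reservoir:
  fixes Cv :: "'e::countable \<Rightarrow> nat \<Rightarrow> nat set \<Rightarrow> bool"
  assumes inf: "infinite B"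
    and ce: "\<And>S. S \<subseteq> B \<Longrightarrow> infinite S \<Longrightarrow> \<exists>e. \<forall>n. n \<in> A \<longleftrightarrow> (\<exists>m\<in>S. Cv e n (S \<inter> {..m}))"
    and ne: "\<And>e n. \<not> Cv e n {}"
    and mono: "\<And>e n S m m'. m \<le> m' \<Longrightarrow> m \<in> S \<Longrightarrow> m' \<in> S \<Longrightarrow> Cv e n (S \<inter> {..m}) \<Longrightarrow> Cv e n (S \<inter> {..m'})"
  obtains e F Q X where "finite F" "finite Q" "\<forall>(e, F', n)\<in>Q. finite F'" "reservoir Cv B F Q X"
    "\<And>n H. n \<notin> A \<Longrightarrow> finite H \<Longrightarrow> H \<subseteq> X \<Longrightarrow> \<not> Cv e n (F \<union> H)"
    "\<And>n Y. n \<in> A \<Longrightarrow> reservoir Cv B F Q Y \<Longrightarrow> \<exists>H\<subseteq>Y. finite H \<and> Cv e n (F \<union> H)"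
proof (rule ccontr)
  assume neg: "\<not> thesis"
  note uniform = that
  have diagonal: "(\<exists>n H. n \<notin> A \<and> finite H \<and> H \<subseteq> X \<and> Cv e n (F \<union> H)) \<or>
      (\<exists>n Y. n \<in> A \<and> reservoir Cv B F Q Y \<and> (\<forall>H\<subseteq>Y. finite H \<longrightarrow> \<not> Cv e n (F \<union> H)))"
    if cond: "finite F" "finite Q" "\<forall>(e, F', n)\<in>Q. finite F'" "reservoir Cv B F Q X" for F Q X e
  proof (rule ccontr)
    assume "\<not> ?thesis"
    then have thesis by (intro uniform[OF cond, of e]) blast+
    with neg show False by contradiction
  qed
  \<comment> \<open>The existence of a reservoir is required, but the reservoir is not part of the
    chain and may be replaced at every step.\<close>
  let ?ok = "\<lambda>(F, Q). finite F \<and> F \<subseteq> B \<and> finite Q \<and> (\<forall>(e, F', n)\<in>Q. finite F') \<and> (\<exists>X. reservoir Cv B F Q X)"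
  have step: "\<exists>s'. ?ok s' \<and> (extends s s' \<and> fst s \<noteq> fst s' \<and> decides A Cv e (fst s') (snd s'))"
    if ok: "?ok s" for s and e :: 'e
  proof -
    obtain F Q where s: "s = (F, Q)" by (cases s)
    obtain X where X: "reservoir Cv B F Q X" using ok unfolding s by auto
    have fin: "finite F" "F \<subseteq> B" "finite Q" "\<forall>(e, F', n)\<in>Q. finite F'" using ok unfolding s by auto
    have okI: "?ok (F \<union> D, shift_stems D Q')" if "finite D" "D \<subseteq> B" "finite Q'" "\<forall>(e, F', n)\<in>Q'. finite F'"
      "reservoir Cv B (F \<union> D) (shift_stems D Q') Y" for D Q' Y
      using finite_shift_stems[OF that(3,4,1)] that(1,2,5) fin(1,2) by (auto intro: exI[of _ Y])
    consider n H where "n \<notin> A" "finite H" "H \<subseteq> X" "Cv e n (F \<union> H)"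
      | n Y where "n \<in> A" "reservoir Cv B F Q Y" "\<And>H. H \<subseteq> Y \<Longrightarrow> finite H \<Longrightarrow> \<not> Cv e n (F \<union> H)"
      using diagonal[OF fin(1,3,4) X, of e] by blast
    then show ?thesis
    proof cases
      case (1 n H)
      obtain x where x: "x \<in> X" "\<forall>h\<in>H. h < x" "extends (F, Q) (F \<union> insert x H, shift_stems (insert x H) Q)"
        "reservoir Cv B (F \<union> insert x H) (shift_stems (insert x H) Q) (X \<inter> {x<..})"
        using extend_condition[OF X 1(3,2)] .
      have "x \<notin> F" "X \<subseteq> B" "\<forall>z\<in>F. z < x" using X x(1) unfolding reservoir_def by auto
      \<comment> \<open>The witness is \<open>F \<union> H\<close> without \<open>x\<close>: the
        wrong acceptance concerns exactly this set, and \<open>x\<close> lies above it.\<close>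
      then have "decides A Cv e (F \<union> insert x H) (shift_stems (insert x H) Q)"
        unfolding decides_def using 1 x(2) by (intro exI[of _ "F \<union> H"]) auto
      moreover have "?ok (F \<union> insert x H, shift_stems (insert x H) Q)"
        using 1 \<open>X \<subseteq> B\<close> x by (intro okI[OF _ _ fin(3,4) x(4)]) auto
      ultimately show ?thesis using x(3) \<open>x \<notin> F\<close> unfolding s
        by (intro exI[of _ "(F \<union> insert x H, shift_stems (insert x H) Q)"]) auto
    next
      case (2 n Y)
      \<comment> \<open>\<open>Y\<close> keeps the new promise by the case assumption. It is added
        before the stem grows, so that \<open>shift_stems\<close> also yields its variant with
        \<open>x\<close>.\<close>
      let ?Q = "insert (e, F, n) Q"
      have Y: "reservoir Cv B F ?Q Y" using 2(2,3) unfolding reservoir_def avoids_def by auto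
      obtain x where x: "x \<in> Y" "extends (F, ?Q) (F \<union> {x}, shift_stems {x} ?Q)"
        "reservoir Cv B (F \<union> {x}) (shift_stems {x} ?Q) (Y \<inter> {x<..})"
        using extend_condition[OF Y, of "{}"] by auto
      have "x \<notin> F" "Y \<subseteq> B" "\<forall>z\<in>F. z < x" using Y x(1) unfolding reservoir_def by auto
      have "(e, F \<union> H, n) \<in> shift_stems {x} ?Q" if "H \<subseteq> (F \<union> {x}) - F" for H
        using x(2) that by simp
      then have "decides A Cv e (F \<union> {x}) (shift_stems {x} ?Q)"
        unfolding decides_def using 2(1) \<open>\<forall>z\<in>F. z < x\<close> by (intro exI[of _ F]) auto
      moreover have "?ok (F \<union> {x}, shift_stems {x} ?Q)"
      proof (rule okI[OF _ _ _ _ x(3)])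
        show "{x} \<subseteq> B" using \<open>Y \<subseteq> B\<close> x(1) by blast
        show "finite ?Q" "\<forall>(e, F', n)\<in>?Q. finite F'" using fin by auto
      qed simp
      moreover have "extends (F, Q) (F \<union> {x}, shift_stems {x} ?Q)" using x(2) by auto
      ultimately show ?thesis using \<open>x \<notin> F\<close> unfolding s
        by (intro exI[of _ "(F \<union> {x}, shift_stems {x} ?Q)"]) auto
    qed
  qed
  have "?ok ({}, {})" using inf unfolding reservoir_def avoids_def by auto
  define cs where "cs = Collect ?ok"
  define R where "R i s s' \<longleftrightarrow> extends s s' \<and> fst s \<noteq> fst s' \<and>
    decides A Cv (from_nat i) (fst s') (snd s')" for i s s'
  have "\<exists>s. s \<in> cs" using \<open>?ok ({}, {})\<close> unfolding cs_def by blast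
  moreover have "\<exists>s'. s' \<in> cs \<and> R i s s'" if "s \<in> cs" for s i
    using step[of s "from_nat i"] that unfolding cs_def R_def by simp
  ultimately obtain s where s': "\<And>i. s i \<in> cs" "\<And>i. R i (s i) (s (Suc i))"
    using dependent_nat_choice[of "\<lambda>i s. s \<in> cs" R] by blast
  have ok: "?ok (s i)" for i using s'(1)[of i] unfolding cs_def by simp
  have s: "extends (s i) (s (Suc i)) \<and> fst (s i) \<noteq> fst (s (Suc i)) \<and>
      decides A Cv (from_nat i) (fst (s (Suc i))) (snd (s (Suc i)))" for i
    using s'(2)[of i] unfolding R_def .
  define F where "F i = fst (s i)" for i
  define Q where "Q i = snd (s i)" for i
  have sFQ: "s i = (F i, Q i)" for i unfolding F_def Q_def by simp
  have ext: "extends (F i, Q i) (F j, Q j)" if "i \<le> j" for i j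
    using that
  proof (induction j rule: dec_induct)
    case (step j)
    then show ?case using extends_trans s[of j] unfolding sFQ by blast
  qed (rule extends_refl)
  define G where "G = (\<Union>i. F i)"
  have FsubG: "F i \<subseteq> G" for i unfolding G_def by (rule UN_upper) simp
  have finF: "finite (F i)" "F i \<subseteq> B" for i using ok[of i] unfolding sFQ by auto
  have subF: "F i \<subseteq> F j" if "i \<le> j" for i j using ext[OF that] by auto
  have FG: "x < y" if xy: "x \<in> F i" "y \<in> G - F i" for x y i
  proof -
    obtain j where j: "y \<in> F j" using xy unfolding G_def by blast
    then have "i \<le> j" using xy subF[of j i] by (meson DiffD2 in_mono nle_le)
    then show ?thesis using ext[of i j] xy j by auto
  qed
  have G_sub: "\<exists>j\<ge>i. K \<subseteq> F j" if "finite K" "K \<subseteq> G" for K i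
    using that
  proof (induction K)
    case (insert x K)
    then obtain j k where "j \<ge> i" "K \<subseteq> F j" "x \<in> F k" unfolding G_def by auto
    then show ?case using subF[of j "max j k"] subF[of k "max j k"] by (intro exI[of _ "max j k"]) auto
  qed auto
  have "infinite G"
  proof
    assume fin: "finite G"
    then obtain j where "G \<subseteq> F j" using G_sub[OF fin subset_refl, of 0] by blast
    then have "F (Suc j) \<subseteq> F j" using FsubG[of "Suc j"] by (rule order.trans[rotated])
    then have "F (Suc j) = F j" using subF[of j "Suc j"] by simp
    then show False using s[of j] unfolding sFQ by simp
  qed
  moreover have "G \<subseteq> B" using finF unfolding G_def by blast
  ultimately obtain e where e: "\<And>n. n \<in> A \<longleftrightarrow> (\<exists>m\<in>G. Cv e n (G \<inter> {..m}))" using ce by blast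
  obtain i where i: "from_nat i = e" by (metis from_nat_to_nat)
  have "decides A Cv e (F (Suc i)) (Q (Suc i))" using s[of i] unfolding sFQ i by simp
  then obtain K where K: "K \<subseteq> F (Suc i)" "\<forall>x\<in>K. \<forall>y\<in>F (Suc i) - K. x < y"
    and dec: "(\<exists>n. n \<notin> A \<and> Cv e n K) \<or> (\<exists>n\<in>A. \<forall>H\<subseteq>F (Suc i) - K. (e, K \<union> H, n) \<in> Q (Suc i))"
    unfolding decides_def by (elim exE conjE) (rule that)
  have finK: "finite K" using K finF finite_subset by blast
  have KG: "x < y" if "x \<in> K" "y \<in> G - K" for x y
  proof (cases "y \<in> F (Suc i)")
    case True
    then show ?thesis using K(2) that by blast
  next
    case False
    then show ?thesis using FG[of x "Suc i" y] K(1) that by blast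
  qed
  have KsubG: "K \<subseteq> G" using K(1) using FsubG by (rule order.trans)
  from dec show False
  proof
    assume "\<exists>n. n \<notin> A \<and> Cv e n K"
    then obtain n where n: "n \<notin> A" "Cv e n K" by blast
    \<comment> \<open>A nonempty \<open>K\<close> is the initial segment of \<open>G\<close> up to
      \<open>Max K\<close>, so the wrong acceptance occurs in the enumeration along \<open>G\<close>
      itself.\<close>
    then have "K \<noteq> {}" using ne by auto
    then have "Max K \<in> K" using finK by simp
    moreover have "G \<inter> {..Max K} = K"
    proof (intro equalityI subsetI)
      fix x assume "x \<in> G \<inter> {..Max K}"
      then show "x \<in> K" using KG[OF \<open>Max K \<in> K\<close>, of x] by (meson DiffI IntE atMost_iff not_less)
    next
      fix x assume "x \<in> K"
      then show "x \<in> G \<inter> {..Max K}" using KsubG finK by auto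
    qed
    ultimately have "\<exists>m\<in>G. Cv e n (G \<inter> {..m})" using n(2) KsubG by (intro bexI[of _ "Max K"]) auto
    then show False using n(1) e by blast
  next
    assume "\<exists>n\<in>A. \<forall>H\<subseteq>F (Suc i) - K. (e, K \<union> H, n) \<in> Q (Suc i)"
    then obtain n where n: "n \<in> A" "\<And>H. H \<subseteq> F (Suc i) - K \<Longrightarrow> (e, K \<union> H, n) \<in> Q (Suc i)" by blast
    from n(1) obtain m where m: "m \<in> G" "Cv e n (G \<inter> {..m})" using e by blast
    \<comment> \<open>The accepting segment is prolonged until it contains \<open>K\<close>, since
      the promise concerns only sets that include \<open>K\<close>.\<close>
    obtain m' where m': "m' \<in> G" "Max (insert m K) < m'" using \<open>infinite G\<close> by (meson infinite_nat_iff_unbounded)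
    then have less: "x < m'" if "x \<in> insert m K" for x
      using finK that by (meson Max_ge finite_insert order.strict_trans1)
    then have "m \<le> m'" and Km': "\<And>x. x \<in> K \<Longrightarrow> x \<le> m'" by (simp_all add: less_imp_le)
    have Cv: "Cv e n (G \<inter> {..m'})" by (rule mono[OF \<open>m \<le> m'\<close> m(1) m'(1) m(2)])
    have "finite (G \<inter> {..m'})" by simp
    from G_sub[OF this Int_lower1, of "Suc i"] obtain j where j: "j \<ge> Suc i" "G \<inter> {..m'} \<subseteq> F j" by blast
    \<comment> \<open>The segment beyond \<open>K\<close> splits at the stem
      \<open>F (Suc i)\<close>: \<open>decides\<close> covers the part inside and
      \<open>extends\<close> the later part. At stage \<open>j\<close> the whole segment is thus the
      stem of a promise, which its instance for the empty set contradicts.\<close>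
    let ?H = "G \<inter> {..m'} - K"
    have KQ: "(e, K \<union> (?H \<inter> F (Suc i)), n) \<in> Q (Suc i)" by (intro n(2)) auto
    have "?H - F (Suc i) \<subseteq> F j - F (Suc i)" using j(2) by blast
    with KQ have "(e, (K \<union> (?H \<inter> F (Suc i))) \<union> (?H - F (Suc i)), n) \<in> Q j" by (rule extendsD[OF ext[OF j(1)]])
    moreover have "(K \<union> (?H \<inter> F (Suc i))) \<union> (?H - F (Suc i)) = G \<inter> {..m'}" using KsubG Km' by auto
    ultimately have Qj: "(e, G \<inter> {..m'}, n) \<in> Q j" by simp
    obtain Y where Y: "avoids Cv (Q j) Y" using ok[of j] unfolding sFQ reservoir_def prod.case by (elim conjE exE)
    show False using avoidsD[OF Y Qj finite.emptyI empty_subsetI] Cv unfolding Un_empty_right by (rule notE)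
  qed
qed

section \<open>Thin sets and ultrafilters\<close>

text \<open>Each new element comes from the \<open>U\<close>-large set allowed by the finitely many
  earlier ones, so conditions may depend on the whole past. Elements are added in increasing order,
  which makes \<open>Z \<inter> {..<z}\<close> this past.\<close>

lemma fusion:
  fixes U :: "nat filter"
  assumes U: "U \<noteq> bot" "\<forall>\<^sub>F x in U. x \<in> X" "\<And>m. \<forall>\<^sub>F x in U. m < x"
    and P: "\<And>E. finite E \<Longrightarrow> \<forall>\<^sub>F x in U. P E x"
  obtains Z where "Z \<subseteq> X" "infinite Z" "\<And>z. z \<in> Z \<Longrightarrow> P (Z \<inter> {..<z}) z"
proof -
  let ?step = "\<lambda>E z. P E z \<and> z \<in> X \<and> (\<forall>x\<in>E. x < z)"
  have ex_step: "\<exists>E'. finite E' \<and> (\<exists>z. E' = insert z E \<and> ?step E z)" if "finite E" for E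
  proof -
    have "\<forall>\<^sub>F x in U. ?step E x" using U(2,3) P that by (intro eventually_conj eventually_ball_finite) auto
    then obtain z where "?step E z" using eventually_happens'[OF U(1)] by blast
    then show ?thesis using that by (intro exI[of _ "insert z E"]) auto
  qed
  define R where "R i E E' \<longleftrightarrow> (\<exists>z. E' = insert z E \<and> ?step E z)" for i :: nat and E E'
  define init where "init i E \<longleftrightarrow> finite E \<and> (i = 0 \<longrightarrow> E = {})" for i :: nat and E :: "nat set"
  have "\<exists>E. init 0 E" unfolding init_def by blast
  moreover have "\<exists>E'. init (Suc i) E' \<and> R i E E'" if "init i E" for E i
    using ex_step[of E] that unfolding init_def R_def by blast
  ultimately obtain E where initE: "\<And>i. init i (E i)" and RE: "\<And>i. R i (E i) (E (Suc i))"
    using dependent_nat_choice[of init R] by blast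
  have E0: "E 0 = {}" using initE[of 0] unfolding init_def by blast
  have E: "\<exists>z. E (Suc i) = insert z (E i) \<and> ?step (E i) z" for i using RE unfolding R_def by blast
  from E obtain z where z: "\<And>i. E (Suc i) = insert (z i) (E i)" "\<And>i. ?step (E i) (z i)" by metis
  have zE: "E i = z ` {..<i}" for i by (induction i) (auto simp: E0 z(1) lessThan_Suc)
  have mono: "strict_mono z"
    using z(2) unfolding zE by (intro strict_mono_Suc_iff[THEN iffD2]) auto
  show thesis
  proof (rule that[of "range z"])
    show "range z \<subseteq> X" using z(2) by auto
    show "infinite (range z)" using mono by (simp add: range_inj_infinite strict_mono_imp_inj_on)
    fix y assume "y \<in> range z"
    then obtain i where y: "y = z i" by blast
    have "range z \<inter> {..<z i} = E i" unfolding zE using strict_mono_less[OF mono] by auto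
    then show "P (range z \<inter> {..<y}) y" using z(2) unfolding y by metis
  qed
qed

lemma ex_ultrafilter:
  fixes X :: "nat set"
  assumes "infinite X"
  obtains U where "U \<noteq> bot" "\<forall>\<^sub>F x in U. x \<in> X" "\<And>m. \<forall>\<^sub>F x in U. m < x"
    "\<And>P. eventually P U \<or> (\<forall>\<^sub>F x in U. \<not> P x)"
proof -
  \<comment> \<open>Intersections are required to be infinite, not just nonempty; maximality then
    puts every cofinite set into \<open>M\<close>, and the ultrafilter is nonprincipal.\<close>
  define good :: "nat set set \<Rightarrow> bool" where "good M \<longleftrightarrow> (\<forall>S\<subseteq>M. finite S \<longrightarrow> infinite (X \<inter> \<Inter>S))" for M
  have "\<exists>M\<in>Collect good. \<forall>N\<in>Collect good. M \<subseteq> N \<longrightarrow> N = M"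
  proof (rule subset_Zorn')
    fix \<C> assume C: "subset.chain (Collect good) \<C>"
    have "good (\<Union>\<C>)" unfolding good_def
    proof (intro allI impI)
      fix S assume S: "S \<subseteq> \<Union>\<C>" "finite S"
      show "infinite (X \<inter> \<Inter>S)"
      proof (cases "S = {}")
        case False
        then have "\<C> \<noteq> {}" using S by auto
        then obtain M where "M \<in> \<C>" "S \<subseteq> M" using finite_subset_Union_chain[OF S(2,1) _ C] by blast
        then show ?thesis using C S(2) unfolding subset.chain_def good_def by blast
      qed (use assms in simp)
    qed
    then show "\<Union>\<C> \<in> Collect good" by simp
  qed
  then obtain M where M: "good M" "\<And>N. good N \<Longrightarrow> M \<subseteq> N \<Longrightarrow> N = M" by auto
  have memI: "P \<in> M" if "\<And>S. S \<subseteq> M \<Longrightarrow> finite S \<Longrightarrow> infinite (X \<inter> \<Inter>S \<inter> P)" for P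
  proof -
    have "good (insert P M)" unfolding good_def
    proof (intro allI impI)
      fix S assume "S \<subseteq> insert P M" "finite S"
      then have "infinite (X \<inter> \<Inter>(S - {P}) \<inter> P)" by (intro that) auto
      then show "infinite (X \<inter> \<Inter>S)" by (rule contrapos_nn) (erule finite_subset[rotated], auto)
    qed
    then show ?thesis using M(2) by blast
  qed
  \<comment> \<open>One rule covers supersets, intersections and, with \<open>S = {}\<close>, all
    sets that contain almost all of \<open>X\<close>.\<close>
  have up: "P \<in> M" if R: "S \<subseteq> M" "finite S" "finite (X \<inter> \<Inter>S - P)" for S P
  proof (rule memI)
    fix T assume T: "T \<subseteq> M" "finite T"
    then have "infinite (X \<inter> \<Inter>(S \<union> T))" using R M(1) unfolding good_def by simp
    then show "infinite (X \<inter> \<Inter>T \<inter> P)"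
    proof (rule contrapos_nn)
      assume "finite (X \<inter> \<Inter>T \<inter> P)"
      then have "finite ((X \<inter> \<Inter>T \<inter> P) \<union> (X \<inter> \<Inter>S - P))" using R by simp
      then show "finite (X \<inter> \<Inter>(S \<union> T))" by (rule finite_subset[rotated]) auto
    qed
  qed
  have ultra: "P \<in> M \<or> - P \<in> M" for P
  proof (rule disjCI)
    assume "- P \<notin> M"
    then obtain S where S: "S \<subseteq> M" "finite S" "finite (X \<inter> \<Inter>S \<inter> - P)" using memI by metis
    then show "P \<in> M" by (intro up[of S]) (auto simp: Diff_eq)
  qed
  define U where "U = Abs_filter (\<lambda>P. {x. P x} \<in> M)"
  have "is_filter (\<lambda>P. {x. P x} \<in> M)"
  proof
    show "{x. True} \<in> M" using up[of "{}"] by simp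
    show "{x. P x \<and> Q x} \<in> M" if "{x. P x} \<in> M" "{x. Q x} \<in> M" for P Q
    proof -
      have "X \<inter> \<Inter>{{x. P x}, {x. Q x}} - {x. P x \<and> Q x} = {}" by auto
      then have "finite (X \<inter> \<Inter>{{x. P x}, {x. Q x}} - {x. P x \<and> Q x})" by (metis finite.emptyI)
      then show ?thesis using that by (intro up[of "{{x. P x}, {x. Q x}}"]) blast+
    qed
    show "{x. Q x} \<in> M" if "\<forall>x. P x \<longrightarrow> Q x" "{x. P x} \<in> M" for P Q
    proof -
      have "X \<inter> \<Inter>{{x. P x}} - {x. Q x} = {}" using that by auto
      then have "finite (X \<inter> \<Inter>{{x. P x}} - {x. Q x})" by (metis finite.emptyI)
      then show ?thesis using that by (intro up[of "{{x. P x}}"]) blast+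
    qed
  qed
  then have ev: "eventually P U \<longleftrightarrow> {x. P x} \<in> M" for P unfolding U_def by (rule eventually_Abs_filter)
  show thesis
  proof (rule that[of U])
    have "{} \<notin> M"
    proof
      assume "{} \<in> M"
      then have "infinite (X \<inter> \<Inter>{{}})" using M(1) unfolding good_def by blast
      then show False by simp
    qed
    then show "U \<noteq> bot" unfolding trivial_limit_def ev by simp
    show "\<forall>\<^sub>F x in U. x \<in> X" unfolding ev using up[of "{}"] by simp
    show "\<forall>\<^sub>F x in U. m < x" for m
    proof -
      have "X \<inter> \<Inter>{} - {x. m < x} \<subseteq> {..m}" by auto
      then show ?thesis unfolding ev using finite_subset by (intro up[of "{}"]) blast+
    qed
    show "eventually P U \<or> (\<forall>\<^sub>F x in U. \<not> P x)" for P
      unfolding ev using ultra[of "{x. P x}"] by (simp add: Collect_neg_eq)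
  qed
qed

text \<open>Admits recursion under \<open>eventually\<close> in the inductive definition
  below.\<close>

lemma eventually_mono_rule: "(\<And>x. P x \<longrightarrow> Q x) \<Longrightarrow> eventually P U \<longrightarrow> eventually Q U"
  using eventually_mono by blast

text \<open>Along sequences that are generic for the ultrafilter, \<open>P\<close> becomes true no later than \<open>D\<close>.
  Since \<open>U\<close> is an ultrafilter, failure propagates just like success, so that the outcome at the empty
  set already decides the comparison on every thin set.\<close>

inductive no_later :: "nat filter \<Rightarrow> (nat set \<Rightarrow> bool) \<Rightarrow> (nat set \<Rightarrow> bool) \<Rightarrow> nat set \<Rightarrow> bool"
  for U P D where
  no_later_now: "P G \<Longrightarrow> no_later U P D G"
| no_later_step: "\<not> D G \<Longrightarrow> \<forall>\<^sub>F x in U. no_later U P D (insert x G) \<Longrightarrow> no_later U P D G"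
monos eventually_mono_rule

definition preserves :: "nat filter \<Rightarrow> (nat set \<Rightarrow> bool) \<Rightarrow> (nat set \<Rightarrow> bool) \<Rightarrow> nat set \<Rightarrow> nat \<Rightarrow> bool" where
  "preserves U P D G x \<longleftrightarrow>
     (no_later U P D G \<and> \<not> P G \<longrightarrow> no_later U P D (insert x G)) \<and>
     (\<not> no_later U P D G \<and> \<not> D G \<longrightarrow> \<not> no_later U P D (insert x G))"

text \<open>A positive verdict without \<open>P\<close> comes from the step rule, which supplies
  \<open>U\<close>-many successors. A negative one without \<open>D\<close> means that the premise
  of the step rule fails, and in an ultrafilter the negation then holds for \<open>U\<close>-many
  \<open>x\<close>.\<close>

lemma eventually_preserves:
  assumes "\<And>P. eventually P U \<or> (\<forall>\<^sub>F x in U. \<not> P x)"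
  shows "\<forall>\<^sub>F x in U. preserves U P D G x"
  unfolding preserves_def
proof (intro eventually_conj)
  show "\<forall>\<^sub>F x in U. no_later U P D G \<and> \<not> P G \<longrightarrow> no_later U P D (insert x G)"
    by (cases "no_later U P D G \<and> \<not> P G") (auto elim: no_later.cases)
  show "\<forall>\<^sub>F x in U. \<not> no_later U P D G \<and> \<not> D G \<longrightarrow> \<not> no_later U P D (insert x G)"
    using assms[of "\<lambda>x. no_later U P D (insert x G)"] no_later_step[of D G U P]
    by (cases "\<not> no_later U P D G \<and> \<not> D G") auto
qed

text \<open>The verdict at \<open>{}\<close> is carried along the sets
  \<open>S \<inter> {p..<z}\<close>. At the first \<open>y\<close> with \<open>D\<close>, a positive
  verdict can only stem from \<open>P\<close>, since the step rule needs \<open>\<not> D\<close>. A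
  negative verdict persists up to \<open>y\<close>, as \<open>D\<close> fails before, and excludes
  \<open>P\<close> there.\<close>

lemma no_later_compare:
  assumes pres: "\<And>x. x \<in> S \<Longrightarrow> p \<le> x \<Longrightarrow> preserves U P D (S \<inter> {p..<x}) x"
    and mono: "\<And>G G'. G \<subseteq> G' \<Longrightarrow> P G \<Longrightarrow> P G'"
    and D: "D (S \<inter> {p..<y})" "\<And>z. z < y \<Longrightarrow> \<not> D (S \<inter> {p..<z})"
  shows "no_later U P D {} \<longleftrightarrow> P (S \<inter> {p..<y})"
proof
  assume le: "no_later U P D {}"
  have "P (S \<inter> {p..<z}) \<or> no_later U P D (S \<inter> {p..<z})" for z
  proof (induction z)
    case (Suc z)
    show ?case
    proof (cases "P (S \<inter> {p..<z})")
      case True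
      moreover have "S \<inter> {p..<z} \<subseteq> S \<inter> {p..<Suc z}" by auto
      ultimately show ?thesis using mono by blast
    next
      case False
      then show ?thesis using Suc pres[of z] unfolding preserves_def interval_Int_Suc by auto
    qed
  qed (use le in simp)
  then show "P (S \<inter> {p..<y})" using D(1) no_later.cases by metis
next
  assume P: "P (S \<inter> {p..<y})"
  show "no_later U P D {}"
  proof (rule ccontr)
    assume nle: "\<not> no_later U P D {}"
    have "\<not> no_later U P D (S \<inter> {p..<z})" if "z \<le> y" for z
      using that
    proof (induction z)
      case (Suc z)
      then show ?case using D(2)[of z] pres[of z] unfolding preserves_def interval_Int_Suc by auto
    qed (use nle in simp)
    then show False using P no_later_now by blast
  qed
qed

section \<open>The self-introenumerable case\<close>

lemma eval_upto_Suc_initial: "eval_upto (Suc m) (S \<inter> {..m}) e xs = eval_upto (Suc m) S e xs"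
  by (rule eval_upto_use) auto

text \<open>The largest element of \<open>K\<close> is the time bound, and \<open>Suc m\<close>
  admits the query \<open>m\<close> itself. A finite set is thus its own clock, and convergence is
  decidable from a code of \<open>K\<close>.\<close>

definition converges :: "recf \<Rightarrow> nat \<Rightarrow> nat set \<Rightarrow> bool" where
  "converges e n K \<longleftrightarrow> (\<exists>m\<in>K. K \<subseteq> {..m} \<and> eval_upto (Suc m) K e [n] \<noteq> None)"

lemma not_converges_empty: "\<not> converges e n {}"
  unfolding converges_def by blast

lemma converges_initial:
  assumes "m \<in> S"
  shows "converges e n (S \<inter> {..m}) \<longleftrightarrow> eval_upto (Suc m) S e [n] \<noteq> None"
proof
  assume "converges e n (S \<inter> {..m})"
  then obtain m' where m': "m' \<in> S \<inter> {..m}" "S \<inter> {..m} \<subseteq> {..m'}" "eval_upto (Suc m') (S \<inter> {..m}) e [n] \<noteq> None"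
    unfolding converges_def by blast
  have "m' = m" using m'(1,2) assms by (auto intro: antisym)
  show "eval_upto (Suc m) S e [n] \<noteq> None" using m'(3) unfolding \<open>m' = m\<close> eval_upto_Suc_initial .
next
  assume "eval_upto (Suc m) S e [n] \<noteq> None"
  then show "converges e n (S \<inter> {..m})" unfolding converges_def
    using assms by (intro bexI[of _ m]) (simp_all add: eval_upto_Suc_initial)
qed

lemma eval_upto_not_None_mono:
  assumes "eval_upto t X e xs \<noteq> None" "t \<le> u"
  shows "eval_upto u X e xs \<noteq> None"
proof -
  obtain y where "eval_upto t X e xs = Some y" using assms(1) by (cases "eval_upto t X e xs") simp_all
  from eval_upto_mono[OF this assms(2)] show ?thesis by simp
qed

lemma converges_initial_mono:
  assumes "m \<le> m'" "m \<in> S" "m' \<in> S" "converges e n (S \<inter> {..m})"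
  shows "converges e n (S \<inter> {..m'})"
proof -
  have "eval_upto (Suc m) S e [n] \<noteq> None" using assms(2,4) converges_initial by blast
  then have "eval_upto (Suc m') S e [n] \<noteq> None" by (rule eval_upto_not_None_mono) (use assms(1) in simp)
  then show ?thesis using assms(3) converges_initial by blast
qed

lemma halts_iff_converges:
  assumes "infinite S"
  shows "(\<exists>y. eval S e [n] y) \<longleftrightarrow> (\<exists>m\<in>S. converges e n (S \<inter> {..m}))"
proof
  assume "\<exists>y. eval S e [n] y"
  then obtain t where t: "eval_upto t S e [n] \<noteq> None" unfolding halts_iff_eval_upto by blast
  obtain m where m: "m \<in> S" "t < m" using assms by (meson infinite_nat_iff_unbounded)
  have "eval_upto (Suc m) S e [n] \<noteq> None" by (rule eval_upto_not_None_mono[OF t]) (use m(2) in simp)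
  then show "\<exists>m\<in>S. converges e n (S \<inter> {..m})" using m(1) converges_initial by blast
next
  assume "\<exists>m\<in>S. converges e n (S \<inter> {..m})"
  then show "\<exists>y. eval S e [n] y" unfolding halts_iff_eval_upto using converges_initial by blast
qed

text \<open>\<open>converges\<close> is not monotone under inclusion, as extra elements may change
  oracle answers. Allowing any finite subset restores monotonicity and stays sound, because
  soundness on the reservoir holds for all finite subsets.\<close>

definition appears :: "recf \<Rightarrow> nat set \<Rightarrow> nat \<Rightarrow> nat set \<Rightarrow> bool" where
  "appears e F n H \<longleftrightarrow> (\<exists>H'\<subseteq>H. finite H' \<and> converges e n (F \<union> H'))"

lemma appears_mono: "appears e F n H \<Longrightarrow> H \<subseteq> H' \<Longrightarrow> appears e F n H'"
  unfolding appears_def by blast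

lemma mem_decode_le: "x \<in> set_decode k \<Longrightarrow> 2 ^ x \<le> k"
  unfolding mem_set_decode_iff by auto

lemma mem_decode_less: "x \<in> set_decode k \<Longrightarrow> x < k"
  using mem_decode_le less_exp[of x] by (meson order.strict_trans2)

lemma rpred_converges:
  assumes "rfun \<O> k a" "rfun \<O> k b"
  shows "rpred \<O> k (\<lambda>X xs. converges e (b X xs) (set_decode (a X xs)))"
proof -
  have "rpred \<O> 2 (\<lambda>X xs. \<exists>m<xs ! 0. m \<in> set_decode (xs ! 0) \<and> (\<forall>x<xs ! 0. x \<in> set_decode (xs ! 0) \<longrightarrow> x \<le> m) \<and>
      eval_upto (Suc m) (set_decode (xs ! 0)) e [xs ! 1] \<noteq> None)"
    by (intro rpred_ex rpred_conj rpred_all rpred_imp rpred_mem_decode rpred_le rpred_halts rfun_Suc rfun_nth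
        rfun_tl1 rfun_tl2) simp_all
  moreover have "converges e n (set_decode c) \<longleftrightarrow> (\<exists>m<c. m \<in> set_decode c \<and> (\<forall>x<c. x \<in> set_decode c \<longrightarrow> x \<le> m) \<and>
      eval_upto (Suc m) (set_decode c) e [n] \<noteq> None)" for n c
    unfolding converges_def using mem_decode_less[of _ c] by (auto simp del: not_None_eq)
  ultimately have "rpred \<O> 2 (\<lambda>X xs. converges e (xs ! 1) (set_decode (xs ! 0)))" by (simp only:)
  from rpred_app2[where P = "\<lambda>X c n. converges e n (set_decode c)", OF this assms] show ?thesis .
qed

text \<open>The search is bounded because the code of a union is at most the sum of the codes. A
  candidate only has to lie between \<open>F\<close> and \<open>F \<union> H\<close>, so the subset
  \<open>H'\<close> need not be searched for separately.\<close>

lemma rpred_appears: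
  assumes F: "finite F" and "rfun \<O> k b" "rfun \<O> k a" 
  shows "rpred \<O> k (\<lambda>X xs. appears e F (b X xs) (set_decode (a X xs)))"
proof -
  let ?f = "set_encode F"
  have "rpred \<O> 2 (\<lambda>X xs. \<exists>c<Suc (?f + xs ! 1). (\<forall>x<c. x \<in> set_decode c \<longrightarrow> x \<in> set_decode ?f \<or> x \<in> set_decode (xs ! 1)) \<and>
      (\<forall>x<?f. x \<in> set_decode ?f \<longrightarrow> x \<in> set_decode c) \<and> converges e (xs ! 0) (set_decode c))"
    by (intro rpred_ex rpred_conj rpred_all rpred_imp rpred_disj rpred_mem_decode rpred_converges rfun_Suc rfun_add
        rfun_const rfun_nth rfun_tl1 rfun_tl2) simp_all
  moreover have "appears e F n (set_decode h) \<longleftrightarrow>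
      (\<exists>c<Suc (?f + h). (\<forall>x<c. x \<in> set_decode c \<longrightarrow> x \<in> set_decode ?f \<or> x \<in> set_decode h) \<and>
      (\<forall>x<?f. x \<in> set_decode ?f \<longrightarrow> x \<in> set_decode c) \<and> converges e n (set_decode c))" for n h
  proof
    assume "appears e F n (set_decode h)"
    then obtain H where H: "H \<subseteq> set_decode h" "finite H" "converges e n (F \<union> H)" unfolding appears_def by blast
    let ?c = "set_encode (F \<union> H)"
    have c: "set_decode ?c = F \<union> H" using F H(2) by simp
    have fin: "finite (F \<union> set_decode h)" using F by simp
    have "?c \<le> set_encode (F \<union> set_decode h)"
      unfolding set_encode_def by (rule sum_mono2[OF fin]) (use H(1) in auto)
    also have "\<dots> \<le> ?f + set_encode (set_decode h)"
      unfolding set_encode_def by (subst sum_Un_nat[OF F finite_set_decode]) (rule diff_le_self)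
    finally have "?c < Suc (?f + h)" by simp
    then show "\<exists>c<Suc (?f + h). (\<forall>x<c. x \<in> set_decode c \<longrightarrow> x \<in> set_decode ?f \<or> x \<in> set_decode h) \<and>
      (\<forall>x<?f. x \<in> set_decode ?f \<longrightarrow> x \<in> set_decode c) \<and> converges e n (set_decode c)"
      using H F by (intro exI[of _ ?c]) (auto simp: c)
  next
    assume "\<exists>c<Suc (?f + h). (\<forall>x<c. x \<in> set_decode c \<longrightarrow> x \<in> set_decode ?f \<or> x \<in> set_decode h) \<and>
      (\<forall>x<?f. x \<in> set_decode ?f \<longrightarrow> x \<in> set_decode c) \<and> converges e n (set_decode c)"
    then obtain c where c: "\<And>x. x < c \<Longrightarrow> x \<in> set_decode c \<Longrightarrow> x \<in> F \<or> x \<in> set_decode h"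
      "\<And>x. x < ?f \<Longrightarrow> x \<in> F \<Longrightarrow> x \<in> set_decode c" "converges e n (set_decode c)" using F by auto
    have "F \<subseteq> set_decode c" using c(2) mem_decode_less[of _ ?f] F by auto
    then have "F \<union> (set_decode c \<inter> set_decode h) = set_decode c" using c(1) mem_decode_less[of _ c] by auto
    then show "appears e F n (set_decode h)" unfolding appears_def using c(3)
      by (intro exI[of _ "set_decode c \<inter> set_decode h"]) auto
  qed
  ultimately have "rpred \<O> 2 (\<lambda>X xs. appears e F (xs ! 0) (set_decode (xs ! 1)))" by (simp only:)
  from rpred_app2[where P = "\<lambda>X n h. appears e F n (set_decode h)", OF this assms(2,3)] show ?thesis .
qed

section \<open>Finite parts of the oracle and entry points\<close>

lemma rfun_encode:
  assumes P: "rpred \<O> (Suc k) (\<lambda>X ys. P X (ys ! 0) (tl ys))" and b: "rfun \<O> k b"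
  shows "rfun \<O> k (\<lambda>X xs. set_encode {v. v < b X xs \<and> P X v xs})"
proof -
  have "rlist \<O> (Suc (Suc k)) (Suc k) (\<lambda>X ys. ys ! 0 # tl (tl ys))"
    by (intro rlist_Cons rlist_tl rfun_nth) simp
  from rpred_env[OF P this] have "rpred \<O> (Suc (Suc k)) (\<lambda>X ys. P X (ys ! 0) (tl (tl ys)))" by simp
  then have "rfun \<O> k (\<lambda>X xs. rec_nat 0 (\<lambda>m r. if P X m xs then 2 ^ m + r else r) (b X xs))"
    by (intro rfun_rec rfun_if rfun_const b rfun_tl1 rfun_add rfun_pow2 rfun_nth) simp_all
  moreover have "rec_nat 0 (\<lambda>m r. if P X m xs then 2 ^ m + r else r) n = set_encode {v. v < n \<and> P X v xs}" for X xs n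
  proof (induction n)
    case (Suc n)
    have "{v. v < Suc n \<and> P X v xs} = (if P X n xs then insert n {v. v < n \<and> P X v xs} else {v. v < n \<and> P X v xs})"
      by (auto simp: less_Suc_eq)
    then show ?case using Suc by simp
  qed simp
  ultimately show ?thesis by (simp only:)
qed

lemma rfun_encode_interval:
  assumes "rfun \<O> k p" "rfun \<O> k y"
  shows "rfun \<O> k (\<lambda>X xs. set_encode (X \<inter> {p X xs..<y X xs}))"
proof -
  have "rfun \<O> 2 (\<lambda>X xs. set_encode {v. v < xs ! 1 \<and> (v \<in> X \<and> xs ! 0 \<le> v)})"
    by (intro rfun_encode rpred_conj rpred_mem_oracle rpred_le rfun_nth rfun_tl1) simp_all
  moreover have "{v. v < y \<and> (v \<in> X \<and> p \<le> v)} = X \<inter> {p..<y}" for X and p y :: nat by auto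
  ultimately have "rfun \<O> 2 (\<lambda>X xs. set_encode (X \<inter> {xs ! 0..<xs ! 1}))" by (simp only:)
  from rfun_app2[where F = "\<lambda>X p y. set_encode (X \<inter> {p..<y})", OF this assms] show ?thesis .
qed

text \<open>The element \<open>w \<ge> a\<close> below the value is what matters: in a thin set,
  every element from the value on was chosen with \<open>w\<close> in its past, hence respects all
  parameters up to \<open>w\<close>, in particular those up to \<open>a\<close>.\<close>

definition next_after :: "nat set \<Rightarrow> nat \<Rightarrow> nat" where
  "next_after S a = (LEAST p. p \<in> S \<and> (\<exists>w<p. w \<in> S \<and> a \<le> w))"

lemma ex_next_after:
  fixes S :: "nat set"
  assumes "infinite S"
  shows "\<exists>p. p \<in> S \<and> (\<exists>w<p. w \<in> S \<and> a \<le> w)"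
proof -
  obtain w where w: "w \<in> S" "a < w" using assms by (meson infinite_nat_iff_unbounded)
  obtain p where "p \<in> S" "w < p" using assms by (meson infinite_nat_iff_unbounded)
  then show ?thesis using w by (intro exI[of _ p]) auto
qed

lemma next_after:
  assumes "infinite S"
  obtains w where "next_after S a \<in> S" "w < next_after S a" "w \<in> S" "a \<le> w"
  using LeastI_ex[OF ex_next_after[OF assms, of a]] unfolding next_after_def by blast

lemma rfun_next_after:
  assumes "\<And>S. S \<in> \<O> \<Longrightarrow> infinite S" "rfun \<O> k a"
  shows "rfun \<O> k (\<lambda>X xs. next_after X (a X xs))"
proof (rule rfun_app1[OF _ assms(2)])
  show "rfun \<O> 1 (\<lambda>X xs. next_after X (xs ! 0))"
    unfolding next_after_def
  proof (rule rfun_Least)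
    show "rpred \<O> (Suc 1) (\<lambda>X ys. ys ! 0 \<in> X \<and> (\<exists>w<ys ! 0. w \<in> X \<and> tl ys ! 0 \<le> w))"
      by (intro rpred_conj rpred_ex rpred_mem_oracle rpred_le rfun_nth rfun_tl1 rfun_tl2) simp_all
    show "\<exists>v. v \<in> X \<and> (\<exists>w<v. w \<in> X \<and> xs ! 0 \<le> w)" if "X \<in> \<O>" for X xs
      using ex_next_after[OF assms(1)[OF that]] .
  qed
qed

text \<open>A number \<open>d\<close> known to be in \<open>A\<close> serves as a clock: it
  certainly appears on \<open>S\<close>, and a rejection can be based on what has appeared by then.
  The relation \<open>le\<close> tells which numbers this clock is slow enough for.\<close>

lemma self_introenumerable_case:
  fixes P :: "nat \<Rightarrow> nat set \<Rightarrow> bool"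
  assumes X: "infinite X"
    and rP: "\<And>\<O> k b a. rfun \<O> k b \<Longrightarrow> rfun \<O> k a \<Longrightarrow> rpred \<O> k (\<lambda>Y xs. P (b Y xs) (set_decode (a Y xs)))"
    and mono: "\<And>n H H'. P n H \<Longrightarrow> H \<subseteq> H' \<Longrightarrow> P n H'"
    and sound: "\<And>n H. P n H \<Longrightarrow> finite H \<Longrightarrow> H \<subseteq> X \<Longrightarrow> n \<in> A"
    and complete: "\<And>n Y. n \<in> A \<Longrightarrow> Y \<subseteq> X \<Longrightarrow> infinite Y \<Longrightarrow> \<exists>y. P n (Y \<inter> {..<y})"
    and A: "infinite A" "\<And>S. S \<subseteq> A \<Longrightarrow> infinite S \<Longrightarrow> ce_in S A"
  shows "\<exists>C\<subseteq>X. infinite C \<and> rpred {S. S \<subseteq> C \<and> infinite S} 1 (\<lambda>S xs. xs ! 0 \<in> A)"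
proof -
  obtain U where U: "U \<noteq> bot" "\<forall>\<^sub>F x in U. x \<in> X" "\<And>m. \<forall>\<^sub>F x in U. m < x"
    and ultra: "\<And>Q. eventually Q U \<or> (\<forall>\<^sub>F x in U. \<not> Q x)"
    using ex_ultrafilter[OF X] by blast
  define le where "le n d \<longleftrightarrow> no_later U (P n) (P d) {}" for n d
  \<comment> \<open>All subsets \<open>G\<close> of the past are included because an infinite subset
    of \<open>Z\<close> may skip elements.\<close>
  define thin where "thin g E x \<longleftrightarrow> (\<forall>w\<in>E. \<forall>n\<in>{..w}. g n < x) \<and>
      (\<forall>w\<in>E. \<forall>n\<in>{..w}. \<forall>d\<in>{..w}. \<forall>G\<in>Pow E. preserves U (P n) (P d) G x)" for g :: "nat \<Rightarrow> nat" and E x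
  have ev: "\<forall>\<^sub>F x in U. thin g E x" if "finite E" for g E
    unfolding thin_def using that U(3) eventually_preserves[OF ultra]
    by (intro eventually_conj eventually_ball_finite ballI) simp_all
  have clock: "P d (S \<inter> {p..<LEAST y. P d (S \<inter> {p..<y})})"
    "z < (LEAST y. P d (S \<inter> {p..<y})) \<Longrightarrow> \<not> P d (S \<inter> {p..<z})"
    "\<exists>y. P d (S \<inter> {p..<y})"
    if S: "S \<subseteq> X" "infinite S" "d \<in> A" for S d p z
  proof -
    have "S = (S \<inter> {p..}) \<union> (S \<inter> {..<p})" by auto
    then have "infinite (S \<inter> {p..})" using S(2) by (metis finite_Un finite_Int finite_lessThan)
    moreover have "S \<inter> {p..} \<subseteq> X" using S(1) by blast
    ultimately obtain y where "P d (S \<inter> {p..} \<inter> {..<y})" using complete[OF S(3)] by blast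
    moreover have "S \<inter> {p..} \<inter> {..<y} = S \<inter> {p..<y}" by auto
    ultimately show ex: "\<exists>y. P d (S \<inter> {p..<y})" by auto
    show "P d (S \<inter> {p..<LEAST y. P d (S \<inter> {p..<y})})" using LeastI_ex[OF ex] .
    show "z < (LEAST y. P d (S \<inter> {p..<y})) \<Longrightarrow> \<not> P d (S \<inter> {p..<z})" by (rule not_less_Least)
  qed
  \<comment> \<open>Waiting for \<open>d\<close> from the entry point \<open>p\<close> reveals
    \<open>le n d\<close>. As \<open>le\<close> does not mention \<open>S\<close>, all subsets of a
    thin set give the same answer.\<close>
  have compare: "le n d \<longleftrightarrow> P n (S \<inter> {p..<LEAST y. P d (S \<inter> {p..<y})})"
    if Z: "\<And>z. z \<in> Z \<Longrightarrow> thin g (Z \<inter> {..<z}) z" and S: "S \<subseteq> Z" "Z \<subseteq> X" "infinite S"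
      and nd: "n \<le> a" "d \<le> a" and d: "d \<in> A" and p: "p = next_after S a" for g Z S n d a p
    unfolding le_def
  proof (rule no_later_compare)
    obtain w where w: "w < p" "w \<in> S" "a \<le> w" using next_after[OF S(3), of a] p by blast
    fix x assume x: "x \<in> S" "p \<le> x"
    have "w \<in> Z \<inter> {..<x}" "S \<inter> {p..<x} \<in> Pow (Z \<inter> {..<x})" "n \<in> {..w}" "d \<in> {..w}" using w x S(1) nd by auto
    moreover have "thin g (Z \<inter> {..<x}) x" using Z x(1) S(1) by blast
    ultimately show "preserves U (P n) (P d) (S \<inter> {p..<x}) x" unfolding thin_def by blast
  next
    have "S \<subseteq> X" using S by blast
    then show "P d (S \<inter> {p..<LEAST y. P d (S \<inter> {p..<y})})"
      "\<And>z. z < (LEAST y. P d (S \<inter> {p..<y})) \<Longrightarrow> \<not> P d (S \<inter> {p..<z})"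
      using clock[OF _ S(3) d] by blast+
  qed (rule mono)
  have sparse: "g n < next_after S n" if Z: "\<And>z. z \<in> Z \<Longrightarrow> thin g (Z \<inter> {..<z}) z" and S: "S \<subseteq> Z" "infinite S"
    for g Z S n
  proof -
    obtain w where w: "next_after S n \<in> S" "w < next_after S n" "w \<in> S" "n \<le> w" using next_after[OF S(2)] .
    then have "w \<in> Z \<inter> {..<next_after S n}" "n \<in> {..w}" "next_after S n \<in> Z" using S(1) by auto
    then show ?thesis using Z unfolding thin_def by blast
  qed
  have rP': "rpred \<O> k (\<lambda>Y xs. P (b Y xs) (Y \<inter> {p Y xs..<y Y xs}))"
    if "rfun \<O> k b" "rfun \<O> k p" "rfun \<O> k y" for \<O> k b p y
    using rP[OF that(1) rfun_encode_interval[OF that(2,3)]] by simp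
  show ?thesis
  proof (cases "\<exists>d\<in>A. infinite {n \<in> A. le n d}")
    case True
    then obtain d where d: "d \<in> A" "infinite {n \<in> A. le n d}" by blast
    define A0 where "A0 = {n \<in> A. le n d}"
    have "ce_in A0 A" using A(2)[of A0] d(2) unfolding A0_def by blast
    then obtain f where f: "n \<in> A \<longleftrightarrow> (\<exists>t. eval_upto t A0 f [n] \<noteq> None)" for n
      unfolding ce_in_def halts_iff_eval_upto by (elim exE) (rule that, erule spec)
    \<comment> \<open>This stage depends on \<open>n\<close> alone, so a thin set dominates
      it.\<close>
    define g where "g n = (LEAST t. eval_upto t A0 f [n] \<noteq> None)" for n
    obtain Z where Z: "Z \<subseteq> X" "infinite Z" "\<And>z. z \<in> Z \<Longrightarrow> thin g (Z \<inter> {..<z}) z"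
      by (rule fusion[where P = "thin g", OF U ev]) (simp_all add: that)
    define \<O> where "\<O> = {S. S \<subseteq> Z \<and> infinite S}"
    have \<O>: "S \<subseteq> Z" "infinite S" "S \<subseteq> X" if "S \<in> \<O>" for S using that Z(1) unfolding \<O>_def by auto
    \<comment> \<open>The sum of the two numbers is just a common bound for both, as
      \<open>compare\<close> needs.\<close>
    have "rpred \<O> 1 (\<lambda>S xs. P (xs ! 0) (S \<inter> {next_after S (xs ! 0 + d)..<
        LEAST y. P d (S \<inter> {next_after S (xs ! 0 + d)..<y})}))"
      by (intro rP' rfun_nth rfun_next_after rfun_Least rfun_const rfun_add rfun_tl1 clock(3) \<O> d(1)) simp_all
    moreover have "P n (S \<inter> {next_after S (n + d)..<LEAST y. P d (S \<inter> {next_after S (n + d)..<y})}) \<longleftrightarrow> n \<in> A0"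
      if S: "S \<in> \<O>" for S n
    proof -
      have "le n d \<longleftrightarrow> P n (S \<inter> {next_after S (n + d)..<LEAST y. P d (S \<inter> {next_after S (n + d)..<y})})"
        by (rule compare[OF Z(3) \<O>(1)[OF S] Z(1) \<O>(2)[OF S], where a = "n + d"]) (simp_all add: d(1))
      moreover have "n \<in> A" if "P n (S \<inter> {p..<y})" for p y
        by (rule sound[OF that]) (use \<O>(3)[OF S] in auto)
      ultimately show ?thesis unfolding A0_def by blast
    qed
    ultimately have A0: "rpred \<O> 1 (\<lambda>S xs. xs ! 0 \<in> A0)"
      using rpred_cong[of \<O> 1 "\<lambda>S xs. P (xs ! 0) (S \<inter> {next_after S (xs ! 0 + d)..<
        LEAST y. P d (S \<inter> {next_after S (xs ! 0 + d)..<y})})" "\<lambda>S xs. xs ! 0 \<in> A0"] by blast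
    \<comment> \<open>By the use principle only \<open>A0\<close> below the time bound matters, and
      this finite part is computable from \<open>S\<close>.\<close>
    have "rpred \<O> 1 (\<lambda>S xs. eval_upto (next_after S (xs ! 0))
        (set_decode (set_encode {v. v < next_after S (xs ! 0) \<and> v \<in> A0})) f [xs ! 0] \<noteq> None)"
      by (intro rpred_halts rfun_next_after rfun_encode rfun_nth \<O> rpred_app1[where P = "\<lambda>S v. v \<in> A0", OF A0]) simp_all
    moreover have "eval_upto (next_after S n) (set_decode (set_encode {v. v < next_after S n \<and> v \<in> A0})) f [n] \<noteq> None
        \<longleftrightarrow> n \<in> A" if S: "S \<in> \<O>" for S n
    proof -
      have "eval_upto (next_after S n) (set_decode (set_encode {v. v < next_after S n \<and> v \<in> A0})) f [n] =
          eval_upto (next_after S n) A0 f [n]" by (rule eval_upto_use) simp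
      moreover have "eval_upto (next_after S n) A0 f [n] \<noteq> None" if n: "n \<in> A"
      proof (rule eval_upto_not_None_mono)
        show "eval_upto (g n) A0 f [n] \<noteq> None" unfolding g_def using n f by (metis (mono_tags, lifting) LeastI_ex)
        show "g n \<le> next_after S n" using sparse[OF Z(3) \<O>(1,2)[OF S]] by (rule less_imp_le)
      qed
      ultimately show ?thesis using f by metis
    qed
    ultimately have "rpred \<O> 1 (\<lambda>S xs. xs ! 0 \<in> A)"
      using rpred_cong[of \<O> 1 "\<lambda>S xs. eval_upto (next_after S (xs ! 0))
        (set_decode (set_encode {v. v < next_after S (xs ! 0) \<and> v \<in> A0})) f [xs ! 0] \<noteq> None" "\<lambda>S xs. xs ! 0 \<in> A"] by blast
    then show ?thesis using Z(1,2) unfolding \<O>_def by blast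
  next
    case False
    then have fin: "finite {m \<in> A. le m n}" if "n \<in> A" for n using that by blast
    \<comment> \<open>A member of \<open>A\<close> above \<open>g n\<close> appears strictly after
      \<open>n\<close> on thin sets, so it is a clock slow enough for \<open>n\<close>.\<close>
    define g where "g n = (if n \<in> A then Max (insert 0 {m \<in> A. le m n}) else 0)" for n
    have g: "\<not> le d n" if "n \<in> A" "d \<in> A" "g n < d" for n d
    proof
      assume "le d n"
      then have "d \<le> Max (insert 0 {m \<in> A. le m n})" using that(2) fin[OF that(1)] by (intro Max_ge) auto
      then show False using that unfolding g_def by simp
    qed
    obtain Z where Z: "Z \<subseteq> X" "infinite Z" "\<And>z. z \<in> Z \<Longrightarrow> thin g (Z \<inter> {..<z}) z"
      by (rule fusion[where P = "thin g", OF U ev]) (simp_all add: that)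
    define \<O> where "\<O> = {S. S \<subseteq> Z \<and> infinite S}"
    have \<O>: "S \<subseteq> Z" "infinite S" "S \<subseteq> X" if "S \<in> \<O>" for S using that Z(1) unfolding \<O>_def by auto
    have sound': "d \<in> A" if "P d (S \<inter> {p..<y})" "S \<in> \<O>" for S d p y
      by (rule sound[OF that(1)]) (use \<O>(3)[OF that(2)] in auto)
    \<comment> \<open>Searches for a clock above \<open>next_after S n\<close>, hence above
      \<open>g n\<close>, that \<open>S\<close> itself shows to be in \<open>A\<close>. The search
      may start at 0 because it relies on soundness, not on thinness; \<open>d < y\<close> keeps it
      decidable.\<close>
    define y1 where "y1 S n = (LEAST y. \<exists>d<y. next_after S n \<le> d \<and> P d (S \<inter> {0..<y}))" for S n
    have ex_y1: "\<exists>y. \<exists>d<y. next_after S n \<le> d \<and> P d (S \<inter> {0..<y})" if S: "S \<in> \<O>" for S n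
    proof -
      obtain d where d: "d \<in> A" "next_after S n < d" using A(1) by (meson infinite_nat_iff_unbounded)
      obtain y where y: "P d (S \<inter> {0..<y})" using clock(3)[OF \<O>(3,2)[OF S] d(1)] by blast
      have "P d (S \<inter> {0..<max y (Suc d)})" by (rule mono[OF y]) auto
      then show ?thesis using d by (intro exI[of _ "max y (Suc d)"] exI[of _ d]) auto
    qed
    define d1 where "d1 S n = (LEAST d. next_after S n \<le> d \<and> P d (S \<inter> {0..<y1 S n}))" for S n
    have ex_d1: "\<exists>d. next_after S n \<le> d \<and> P d (S \<inter> {0..<y1 S n})" if S: "S \<in> \<O>" for S n
      using LeastI_ex[OF ex_y1[OF S, of n]] unfolding y1_def by blast
    have d1: "next_after S n \<le> d1 S n" "d1 S n \<in> A" if S: "S \<in> \<O>" for S n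
    proof -
      have *: "next_after S n \<le> d1 S n \<and> P (d1 S n) (S \<inter> {0..<y1 S n})"
        unfolding d1_def using ex_d1[OF S] by (rule LeastI_ex)
      then show "next_after S n \<le> d1 S n" by blast
      show "d1 S n \<in> A" by (rule sound'[OF conjunct2[OF *] S])
    qed
    \<comment> \<open>The clock is restarted: thinness compares \<open>n\<close> with
      \<open>d1 S n\<close> only from an entry point beyond both.\<close>
    define p2 where "p2 S n = next_after S (n + d1 S n)" for S n
    have r1: "rfun \<O> 1 (\<lambda>S xs. y1 S (xs ! 0))"
      unfolding y1_def
      by (rule rfun_Least) (intro rpred_ex rpred_conj rpred_le rP' rfun_next_after rfun_const rfun_nth rfun_tl1 rfun_tl2 \<O>, simp_all add: ex_y1)
    have r2: "rfun \<O> 1 (\<lambda>S xs. d1 S (xs ! 0))"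
      unfolding d1_def
      by (rule rfun_Least) (intro rpred_conj rpred_le rP' rfun_next_after rfun_const rfun_nth rfun_tl1 \<O>
          rfun_app1[where F = y1, OF r1], simp_all add: ex_d1)
    have r3: "rfun \<O> 1 (\<lambda>S xs. p2 S (xs ! 0))"
      unfolding p2_def by (intro rfun_next_after rfun_add rfun_nth \<O> r2) simp_all
    have "rpred \<O> 1 (\<lambda>S xs. P (xs ! 0) (S \<inter> {p2 S (xs ! 0)..<LEAST y. P (d1 S (xs ! 0)) (S \<inter> {p2 S (xs ! 0)..<y})}))"
      by (intro rP' r3 rfun_nth rfun_Least rfun_app1[where F = p2, OF r3] rfun_app1[where F = d1, OF r2] rfun_tl1
          clock(3) \<O> d1(2)) simp_all
    moreover have "P n (S \<inter> {p2 S n..<LEAST y. P (d1 S n) (S \<inter> {p2 S n..<y})}) \<longleftrightarrow> n \<in> A"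
      if S: "S \<in> \<O>" for S n
    proof
      let ?yd = "LEAST y. P (d1 S n) (S \<inter> {p2 S n..<y})" and ?yn = "LEAST y. P n (S \<inter> {p2 S n..<y})"
      assume n: "n \<in> A"
      have "g n < d1 S n" using sparse[OF Z(3) \<O>(1,2)[OF S], of n] d1(1)[OF S, of n] by (rule order.strict_trans2)
      then have "\<not> le (d1 S n) n" by (rule g[OF n d1(2)[OF S]])
      moreover have "le (d1 S n) n \<longleftrightarrow> P (d1 S n) (S \<inter> {p2 S n..<?yn})"
        by (rule compare[OF Z(3) \<O>(1)[OF S] Z(1) \<O>(2)[OF S], where a = "n + d1 S n"]) (simp_all add: n p2_def)
      ultimately have nd: "\<not> P (d1 S n) (S \<inter> {p2 S n..<?yn})" by blast
      have "?yn \<le> ?yd"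
      proof (rule ccontr)
        assume "\<not> ?yn \<le> ?yd"
        then have "S \<inter> {p2 S n..<?yd} \<subseteq> S \<inter> {p2 S n..<?yn}" by auto
        with mono[OF clock(1)[OF \<O>(3,2)[OF S] d1(2)[OF S]]] nd show False by blast
      qed
      then have "S \<inter> {p2 S n..<?yn} \<subseteq> S \<inter> {p2 S n..<?yd}" by auto
      then show "P n (S \<inter> {p2 S n..<?yd})" by (rule mono[OF clock(1)[OF \<O>(3,2)[OF S] n]])
    qed (rule sound'[OF _ S])
    ultimately have "rpred \<O> 1 (\<lambda>S xs. xs ! 0 \<in> A)"
      using rpred_cong[of \<O> 1 "\<lambda>S xs. P (xs ! 0) (S \<inter> {p2 S (xs ! 0)..<LEAST y. P (d1 S (xs ! 0)) (S \<inter> {p2 S (xs ! 0)..<y})})"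
          "\<lambda>S xs. xs ! 0 \<in> A"] by blast
    then show ?thesis using Z(1,2) unfolding \<O>_def by blast
  qed
qed

section \<open>The computable ordinal case\<close>

text \<open>The Kleene-Brouwer order on increasing sequences, read off their ranges: a proper end extension
  is smaller, and otherwise the sequence with the smaller entry at the first difference is.\<close>

definition kb_less :: "nat set \<Rightarrow> nat set \<Rightarrow> bool" where
  "kb_less K L \<longleftrightarrow> (\<exists>x\<in>K - L. \<forall>y<x. y \<in> K \<longleftrightarrow> y \<in> L)"

lemma kb_less_irrefl: "\<not> kb_less K K"
  unfolding kb_less_def by blast

lemma kb_less_trans:
  assumes "kb_less K L" "kb_less L M"
  shows "kb_less K M"
proof -
  obtain x where x: "x \<in> K" "x \<notin> L" "\<And>y. y < x \<Longrightarrow> y \<in> K \<longleftrightarrow> y \<in> L" using assms(1) unfolding kb_less_def by blast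
  obtain z where z: "z \<in> L" "z \<notin> M" "\<And>y. y < z \<Longrightarrow> y \<in> L \<longleftrightarrow> y \<in> M" using assms(2) unfolding kb_less_def by blast
  consider "x < z" | "z < x" using x(2) z(1) by (metis linorder_neqE_nat)
  then show ?thesis
  proof cases
    case 1
    then have "x \<in> K - M" "\<forall>y<x. y \<in> K \<longleftrightarrow> y \<in> M" using x z(3) by auto
    then show ?thesis unfolding kb_less_def by blast
  next
    case 2
    then have "z \<in> K - M" "\<forall>y<z. y \<in> K \<longleftrightarrow> y \<in> M" using z x(3) by auto
    then show ?thesis unfolding kb_less_def by blast
  qed
qed

lemma kb_less_total:
  assumes "K \<noteq> L"
  shows "kb_less K L \<or> kb_less L K"
proof -
  let ?D = "\<lambda>x. (x \<in> K) \<noteq> (x \<in> L)"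
  have "\<exists>x. ?D x" using assms by blast
  then have "?D (LEAST x. ?D x)" by (rule LeastI_ex)
  moreover have "y \<in> K \<longleftrightarrow> y \<in> L" if "y < (LEAST x. ?D x)" for y using not_less_Least[OF that] by blast
  ultimately show ?thesis unfolding kb_less_def by blast
qed

lemma kb_less_insert: "x \<notin> K \<Longrightarrow> \<forall>k\<in>K. k < x \<Longrightarrow> kb_less (insert x K) K"
  unfolding kb_less_def by auto

text \<open>At the first difference the later set gains an element. So once membership below
  \<open>x\<close> has settled, \<open>x\<close> may enter but never leave, and by induction every
  initial segment settles.\<close>

lemma kb_less_descending_limit:
  assumes desc: "\<And>i. kb_less (f (Suc i)) (f i)"
  obtains Y where "infinite Y" "\<And>x. \<exists>N. \<forall>i\<ge>N. f i \<inter> {..<x} = Y \<inter> {..<x}"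
proof -
  define first where "first i x \<longleftrightarrow> x \<in> f (Suc i) \<and> x \<notin> f i \<and> (\<forall>y<x. y \<in> f (Suc i) \<longleftrightarrow> y \<in> f i)" for i x
  have "\<exists>x. first i x" for i using desc[of i] unfolding kb_less_def first_def by blast
  then have "first i (SOME x. first i x)" for i by (rule someI_ex)
  then obtain v where first: "\<And>i. first i (v i)" by (rule that)
  have v: "v i \<in> f (Suc i)" "v i \<notin> f i" "y < v i \<Longrightarrow> y \<in> f (Suc i) \<longleftrightarrow> y \<in> f i" for i y
    using first[of i] unfolding first_def by simp_all
  have v_ge: "x \<le> v i" if "f (Suc i) \<inter> {..<x} = f i \<inter> {..<x}" for i x
  proof (rule ccontr)
    assume "\<not> x \<le> v i"
    then have "v i \<in> f (Suc i) \<inter> {..<x}" using v(1)[of i] by simp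
    then have "v i \<in> f i \<inter> {..<x}" unfolding that .
    then show False using v(2)[of i] by simp
  qed
  have stable: "\<exists>N. \<forall>i\<ge>N. f i \<inter> {..<x} = f N \<inter> {..<x}" for x
  proof (induction x)
    case (Suc x)
    then obtain N where N: "\<And>i. i \<ge> N \<Longrightarrow> f i \<inter> {..<x} = f N \<inter> {..<x}" by blast
    have keep: "x \<in> f j" if M: "N \<le> M" "M \<le> j" "x \<in> f M" for M j
      using M(2)
    proof (induction j rule: dec_induct)
      case (step j)
      have "x \<le> v j" using step M(1) N[of j] N[of "Suc j"] by (intro v_ge) simp
      then show ?case using v(1)[of j] v(3)[of x j] step.IH by (cases "x = v j") auto
    qed (rule M(3))
    show ?case
    proof (cases "\<exists>M\<ge>N. x \<in> f M")
      case True
      then obtain M where M: "M \<ge> N" "x \<in> f M" by blast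
      have "f i \<inter> {..<Suc x} = f M \<inter> {..<Suc x}" if "i \<ge> M" for i
      proof -
        have "f i \<inter> {..<x} = f M \<inter> {..<x}" using N[of i] N[of M] M(1) that by simp
        then show ?thesis using keep[OF M(1) that M(2)] M(2) by (simp add: lessThan_Suc)
      qed
      then show ?thesis by blast
    next
      case False
      have "f i \<inter> {..<Suc x} = f N \<inter> {..<Suc x}" if "i \<ge> N" for i
        using N[OF that] False that by (simp add: lessThan_Suc)
      then show ?thesis by blast
    qed
  qed simp
  define Y where "Y = {x. \<exists>N. \<forall>i\<ge>N. x \<in> f i}"
  have lim: "\<exists>N. \<forall>i\<ge>N. f i \<inter> {..<x} = Y \<inter> {..<x}" for x
  proof -
    obtain N where N: "\<And>i. i \<ge> N \<Longrightarrow> f i \<inter> {..<x} = f N \<inter> {..<x}" using stable[of x] by blast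
    have "y \<in> f N \<longleftrightarrow> y \<in> Y" if "y < x" for y
    proof
      assume y: "y \<in> f N"
      have "y \<in> f i" if "i \<ge> N" for i using N[OF that] y \<open>y < x\<close> by blast
      then show "y \<in> Y" unfolding Y_def by blast
    next
      assume "y \<in> Y"
      then obtain M where "\<forall>i\<ge>M. y \<in> f i" unfolding Y_def by blast
      then have "y \<in> f (max M N)" by simp
      then show "y \<in> f N" using N[of "max M N"] \<open>y < x\<close> by auto
    qed
    then have "f N \<inter> {..<x} = Y \<inter> {..<x}" by auto
    then show ?thesis using N by metis
  qed
  have "infinite Y"
  proof
    assume "finite Y"
    then obtain x where x: "Y \<subseteq> {..<x}" using finite_nat_iff_bounded by blast
    obtain N where N: "\<And>i. i \<ge> N \<Longrightarrow> f i \<inter> {..<x} = Y \<inter> {..<x}" using lim[of x] by blast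
    have vx: "x \<le> v i" if "i \<ge> N" for i using N[of i] N[of "Suc i"] that by (intro v_ge) simp
    \<comment> \<open>The element \<open>v N\<close> may be lost, but only when a smaller one enters
      that is still at least \<open>x\<close>. So the interval from \<open>x\<close> to
      \<open>v N\<close> stays occupied, and by stabilisation it meets \<open>Y\<close>.\<close>
    have low: "\<exists>z. x \<le> z \<and> z \<le> v N \<and> z \<in> f j" if "Suc N \<le> j" for j
      using that
    proof (induction j rule: dec_induct)
      case base
      then show ?case using v(1)[of N] vx[of N] by blast
    next
      case (step j)
      then obtain z where z: "x \<le> z" "z \<le> v N" "z \<in> f j" by blast
      show ?case
      proof (cases "z < v j")
        case True
        then show ?thesis using z v(3)[of z j] by blast
      next
        case False
        then have "v j \<le> v N" using z(2) by simp
        then show ?thesis using vx[of j] step(1) v(1)[of j] by auto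
      qed
    qed
    obtain M where M: "\<And>i. i \<ge> M \<Longrightarrow> f i \<inter> {..<Suc (v N)} = Y \<inter> {..<Suc (v N)}" using lim by blast
    obtain z where z: "x \<le> z" "z \<le> v N" "z \<in> f (max M (Suc N))" using low[of "max M (Suc N)"] by auto
    then have "z \<in> f (max M (Suc N)) \<inter> {..<Suc (v N)}" by simp
    then have "z \<in> Y" unfolding M[OF max.cobounded1] by (rule IntD1)
    then show False using subsetD[OF x] z(1) by fastforce
  qed
  then show thesis using lim by (rule that)
qed

text \<open>\<open>B\<close> and the promises stand in for the reservoir, which need not be
  computable from \<open>B\<close>. Using \<open>appears\<close> makes the property closed under
  subsets, so that safe finite sets form a tree.\<close>

definition safe :: "nat set \<Rightarrow> (recf \<times> nat set \<times> nat) set \<Rightarrow> recf \<Rightarrow> nat set \<Rightarrow> nat \<Rightarrow> nat set \<Rightarrow> bool" where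
  "safe B Q e F n H \<longleftrightarrow> H \<subseteq> B \<and> (\<forall>y\<in>H. \<forall>x\<in>F. x < y) \<and>
     (\<forall>q\<in>Q. \<not> appears (fst q) (fst (snd q)) (snd (snd q)) H) \<and> \<not> appears e F n H"

lemma safe_mono: "safe B Q e F n H \<Longrightarrow> H' \<subseteq> H \<Longrightarrow> safe B Q e F n H'"
  unfolding safe_def using appears_mono by (meson subsetD subset_trans)

text \<open>The two least elements \<open>n < t\<close> of a node are a number and a stage at which it is seen to be
  in \<open>A\<close>; only the elements above \<open>t\<close> are a position in the tree of \<open>n\<close>. This turns the trees of all
  \<open>n \<in> A\<close> into one computable tree, although \<open>A\<close> is merely c.e. in \<open>B\<close>.\<close>

definition node :: "nat set \<Rightarrow> (recf \<times> nat set \<times> nat) set \<Rightarrow> recf \<Rightarrow> nat set \<Rightarrow> recf \<Rightarrow> nat set \<Rightarrow> bool" where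
  "node B Q e F f K \<longleftrightarrow> (\<forall>n\<in>K. \<forall>t\<in>K. n < t \<and> (\<forall>z\<in>K. z = n \<or> t \<le> z) \<longrightarrow>
     eval_upto t B f [n] \<noteq> None \<and> safe B Q e F n {z \<in> K. t < z})"

definition node_order :: "nat set \<Rightarrow> (recf \<times> nat set \<times> nat) set \<Rightarrow> recf \<Rightarrow> nat set \<Rightarrow> recf \<Rightarrow> (nat \<times> nat) set" where
  "node_order B Q e F f = {(k, l). node B Q e F f (set_decode k) \<and> node B Q e F f (set_decode l) \<and>
     (k = l \<or> kb_less (set_decode k) (set_decode l))}"

section \<open>Computability of the tree order from \<open>B\<close>\<close>

lemma rpred_safe:
  assumes fin: "finite F" "finite Q" "\<forall>(e, F, n)\<in>Q. finite F" and ab: "rfun {B} k b" "rfun {B} k a"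
  shows "rpred {B} k (\<lambda>X xs. safe B Q e F (b X xs) (set_decode (a X xs)))"
proof -
  have finQ: "finite (fst (snd q))" if "q \<in> Q" for q using fin(3) that by (cases q) auto
  have "rpred {B} 2 (\<lambda>X xs. (\<forall>y<xs ! 1. y \<in> set_decode (xs ! 1) \<longrightarrow> y \<in> X) \<and>
      (\<forall>y<xs ! 1. y \<in> set_decode (xs ! 1) \<longrightarrow> (\<forall>x\<in>F. x < y)) \<and>
      (\<forall>q\<in>Q. \<not> appears (fst q) (fst (snd q)) (snd (snd q)) (set_decode (xs ! 1))) \<and>
      \<not> appears e F (xs ! 0) (set_decode (xs ! 1)))"
    by (intro rpred_conj rpred_all rpred_imp rpred_ball rpred_not rpred_appears rpred_mem_decode rpred_mem_oracle rpred_less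
        rfun_const rfun_nth rfun_tl1 fin finQ) simp_all
  then have "rpred {B} 2 (\<lambda>X xs. safe B Q e F (xs ! 0) (set_decode (xs ! 1)))"
  proof (rule rpred_cong[THEN iffD1, rotated])
    fix X and xs :: "nat list" assume "X \<in> {B}"
    then show "(\<forall>y<xs ! 1. y \<in> set_decode (xs ! 1) \<longrightarrow> y \<in> X) \<and>
      (\<forall>y<xs ! 1. y \<in> set_decode (xs ! 1) \<longrightarrow> (\<forall>x\<in>F. x < y)) \<and>
      (\<forall>q\<in>Q. \<not> appears (fst q) (fst (snd q)) (snd (snd q)) (set_decode (xs ! 1))) \<and>
      \<not> appears e F (xs ! 0) (set_decode (xs ! 1)) \<longleftrightarrow> safe B Q e F (xs ! 0) (set_decode (xs ! 1))"
      unfolding safe_def using mem_decode_less[of _ "xs ! 1"] by blast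
  qed
  from rpred_app2[where P = "\<lambda>X n h. safe B Q e F n (set_decode h)", OF this ab] show ?thesis .
qed

lemma rpred_node:
  assumes fin: "finite F" "finite Q" "\<forall>(e, F, n)\<in>Q. finite F" and a: "rfun {B} k a"
  shows "rpred {B} k (\<lambda>X xs. node B Q e F f (set_decode (a X xs)))"
proof -
  have "rpred {B} 1 (\<lambda>X xs. \<forall>n<xs ! 0. \<forall>t<xs ! 0. n \<in> set_decode (xs ! 0) \<and> t \<in> set_decode (xs ! 0) \<and> n < t \<and>
      (\<forall>z<xs ! 0. z \<in> set_decode (xs ! 0) \<longrightarrow> z = n \<or> t \<le> z) \<longrightarrow>
      eval_upto t (set_decode (set_encode {v. v < t \<and> v \<in> X})) f [n] \<noteq> None \<and>
      safe B Q e F n (set_decode (set_encode {z. z < xs ! 0 \<and> z \<in> set_decode (xs ! 0) \<and> t < z})))"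
    by (intro rpred_all rpred_imp rpred_conj rpred_disj rpred_mem_decode rpred_less rpred_le rpred_eq rpred_halts
        rpred_safe[OF fin] rfun_encode rpred_mem_oracle rfun_nth rfun_tl1 rfun_tl2 rfun_tl3) simp_all
  then have "rpred {B} 1 (\<lambda>X xs. node B Q e F f (set_decode (xs ! 0)))"
  proof (rule rpred_cong[THEN iffD1, rotated])
    fix X and xs :: "nat list" assume X: "X \<in> {B}"
    let ?h = "xs ! 0"
    have 1: "eval_upto t (set_decode (set_encode {v. v < t \<and> v \<in> X})) f [n] = eval_upto t B f [n]" for t n
      using X by (intro eval_upto_use) simp
    have 2: "set_decode (set_encode {z. z < ?h \<and> z \<in> set_decode ?h \<and> t < z}) = {z \<in> set_decode ?h. t < z}" for t
      using mem_decode_less[of _ ?h] by auto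
    show "(\<forall>n<?h. \<forall>t<?h. n \<in> set_decode ?h \<and> t \<in> set_decode ?h \<and> n < t \<and>
      (\<forall>z<?h. z \<in> set_decode ?h \<longrightarrow> z = n \<or> t \<le> z) \<longrightarrow>
      eval_upto t (set_decode (set_encode {v. v < t \<and> v \<in> X})) f [n] \<noteq> None \<and>
      safe B Q e F n (set_decode (set_encode {z. z < ?h \<and> z \<in> set_decode ?h \<and> t < z}))) \<longleftrightarrow>
      node B Q e F f (set_decode ?h)"
      unfolding 1 2 node_def using mem_decode_less[of _ ?h] by blast
  qed
  from rpred_app1[where P = "\<lambda>X h. node B Q e F f (set_decode h)", OF this a] show ?thesis .
qed

lemma rel_computable_node_order:
  assumes fin: "finite F" "finite Q" "\<forall>(e, F, n)\<in>Q. finite F"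
  shows "rel_computable B (node_order B Q e F f)"
proof (rule rel_computableI)
  have "rpred {B} 2 (\<lambda>X xs. node B Q e F f (set_decode (xs ! 0)) \<and> node B Q e F f (set_decode (xs ! 1)) \<and>
      (xs ! 0 = xs ! 1 \<or> (\<exists>x<xs ! 0. x \<in> set_decode (xs ! 0) \<and> \<not> x \<in> set_decode (xs ! 1) \<and>
        (\<forall>y<x. y \<in> set_decode (xs ! 0) \<longleftrightarrow> y \<in> set_decode (xs ! 1)))))"
    by (intro rpred_conj rpred_node[OF fin] rpred_disj rpred_eq rpred_ex rpred_all rpred_iff rpred_not rpred_mem_decode
        rfun_nth rfun_tl1 rfun_tl2) simp_all
  moreover have "kb_less (set_decode k) (set_decode l) \<longleftrightarrow>
      (\<exists>x<k. x \<in> set_decode k \<and> \<not> x \<in> set_decode l \<and> (\<forall>y<x. y \<in> set_decode k \<longleftrightarrow> y \<in> set_decode l))" for k l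
    unfolding kb_less_def using mem_decode_less[of _ k] by blast
  ultimately show "rpred {B} 2 (\<lambda>X xs. (xs ! 0, xs ! 1) \<in> node_order B Q e F f)"
    unfolding node_order_def by (simp only: mem_Collect_eq prod.case)
qed

lemma Field_node_order: "Field (node_order B Q e F f) = {k. node B Q e F f (set_decode k)}"
  unfolding Field_def node_order_def by auto

text \<open>A descending sequence has an infinite limit \<open>Y\<close>. Its two least elements are
  a number and a stage, and the rest would be an infinite path through the tree of that number. Sets
  with fewer than two elements are nodes vacuously, which does no harm since the limit is
  infinite.\<close>

lemma Well_order_node_order:
  assumes terminates: "\<And>n t Y. eval_upto t B f [n] \<noteq> None \<Longrightarrow> infinite Y \<Longrightarrow>
      (\<And>H. finite H \<Longrightarrow> H \<subseteq> Y \<Longrightarrow> safe B Q e F n H) \<Longrightarrow> False"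
  shows "Well_order (node_order B Q e F f)"
proof -
  let ?r = "node_order B Q e F f"
  have "refl_on (Field ?r) ?r" unfolding refl_on_def Field_node_order by (auto simp: node_order_def)
  moreover have "?r \<subseteq> Field ?r \<times> Field ?r" unfolding Field_node_order by (auto simp: node_order_def)
  moreover have "trans ?r" unfolding trans_def node_order_def using kb_less_trans by blast
  moreover have "antisym ?r" unfolding antisym_def node_order_def using kb_less_trans kb_less_irrefl by blast
  moreover have "total_on (Field ?r) ?r"
    unfolding total_on_def Field_node_order
  proof (intro ballI impI)
    fix k l assume kl: "k \<in> {k. node B Q e F f (set_decode k)}" "l \<in> {k. node B Q e F f (set_decode k)}" "k \<noteq> l"
    have "set_decode k \<noteq> set_decode l" using kl(3) by (metis set_decode_inverse)
    then show "(k, l) \<in> ?r \<or> (l, k) \<in> ?r" using kb_less_total kl(1,2) unfolding node_order_def by blast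
  qed
  moreover have "wf (?r - Id)"
    unfolding wf_iff_no_infinite_down_chain
  proof
    assume "\<exists>g. \<forall>i. (g (Suc i), g i) \<in> ?r - Id"
    then obtain g where g: "\<And>i. (g (Suc i), g i) \<in> ?r - Id" by blast
    define K where "K i = set_decode (g i)" for i
    have node: "node B Q e F f (K i)" and kb: "kb_less (K (Suc i)) (K i)" for i
      using g[of i] unfolding node_order_def K_def by auto
    obtain Y where Y: "infinite Y" "\<And>x. \<exists>N. \<forall>i\<ge>N. K i \<inter> {..<x} = Y \<inter> {..<x}"
      using kb_less_descending_limit[of K] kb by metis
    define n where "n = (LEAST x. x \<in> Y)"
    have n: "n \<in> Y" "\<And>x. x \<in> Y \<Longrightarrow> n \<le> x"
    proof -
      obtain y where "y \<in> Y" using infinite_imp_nonempty[OF Y(1)] by blast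
      then show "n \<in> Y" unfolding n_def by (rule LeastI)
      show "\<And>x. x \<in> Y \<Longrightarrow> n \<le> x" unfolding n_def by (rule Least_le)
    qed
    define t where "t = (LEAST x. x \<in> Y \<and> n < x)"
    have "\<exists>x. x \<in> Y \<and> n < x" using Y(1) by (meson infinite_nat_iff_unbounded)
    then have t: "t \<in> Y" "n < t" unfolding t_def using LeastI_ex[of "\<lambda>x. x \<in> Y \<and> n < x"] by blast+
    have t_le: "t \<le> x" if "x \<in> Y" "x \<noteq> n" for x
      unfolding t_def using that n(2)[OF that(1)] by (intro Least_le) simp
    \<comment> \<open>Some \<open>K i\<close> agrees with \<open>Y\<close> up to a bound above
      \<open>t\<close> and \<open>H\<close>. Hence \<open>n\<close> and \<open>t\<close> are its two
      least elements too, and its position in the tree includes \<open>H\<close>.\<close>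
    have main: "eval_upto t B f [n] \<noteq> None \<and> safe B Q e F n H" if H: "finite H" "H \<subseteq> Y \<inter> {t<..}" for H
    proof -
      obtain x where x: "insert t H \<subseteq> {..<x}" using finite_nat_iff_bounded[of "insert t H"] H(1) by auto
      obtain i where i: "K i \<inter> {..<x} = Y \<inter> {..<x}" using Y(2)[of x] by blast
      have tx: "t < x" using x by simp
      have mem: "z \<in> K i \<longleftrightarrow> z \<in> Y" if "z < x" for z using i that by blast
      have nK: "n \<in> K i" "t \<in> K i" using mem[of n] mem[of t] n(1) t tx by simp_all
      have "z = n \<or> t \<le> z" if "z \<in> K i" for z
      proof (cases "z < x")
        case True
        then show ?thesis using mem[OF True] that t_le by blast
      qed (use tx in simp)
      then have "eval_upto t B f [n] \<noteq> None \<and> safe B Q e F n {z \<in> K i. t < z}"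
        using node[of i] nK t(2) unfolding node_def by blast
      moreover have "H \<subseteq> {z \<in> K i. t < z}" using H(2) x mem by auto
      ultimately show ?thesis using safe_mono by blast
    qed
    have "Y = (Y \<inter> {t<..}) \<union> (Y \<inter> {..t})" by auto
    then have "infinite (Y \<inter> {t<..})" using Y(1) by (metis finite_Un finite_Int finite_atMost)
    then show False using terminates[of t n "Y \<inter> {t<..}"] main[of "{}"] main by blast
  qed
  ultimately show ?thesis
    unfolding well_order_on_def linear_order_on_def partial_order_on_def preorder_on_def by blast
qed

text \<open>States of the greedy descent: \<open>0\<close> is stuck, \<open>1\<close> is the start above all of \<open>r\<close>, and \<open>v + 2\<close>
  stands for \<open>v\<close> in the field of \<open>r\<close>.\<close>

definition candidate :: "(nat \<times> nat) set \<Rightarrow> nat \<Rightarrow> nat \<Rightarrow> bool" where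
  "candidate r s v \<longleftrightarrow> (v, v) \<in> r \<and> (s = 1 \<or> (v, s - 2) \<in> r \<and> v \<noteq> s - 2)"

definition best_candidate :: "(nat \<times> nat) set \<Rightarrow> nat \<Rightarrow> nat \<Rightarrow> nat \<Rightarrow> bool" where
  "best_candidate r s x v \<longleftrightarrow> candidate r s v \<and> (\<forall>u<Suc x. candidate r s u \<longrightarrow> (u, v) \<in> r)"

definition greedy_step :: "(nat \<times> nat) set \<Rightarrow> nat \<Rightarrow> nat \<Rightarrow> nat" where
  "greedy_step r s x = (if s = 0 then 0 else if \<exists>v<Suc x. best_candidate r s x v
     then Suc (Suc (LEAST v. best_candidate r s x v)) else 0)"

definition greedy :: "(nat \<times> nat) set \<Rightarrow> nat set \<Rightarrow> nat \<Rightarrow> nat \<Rightarrow> nat" where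
  "greedy r S p y = rec_nat 1 (\<lambda>x s. if x \<in> S \<and> p < x then greedy_step r s x else s) y"

lemma greedy_0: "greedy r S p 0 = 1"
  and greedy_Suc: "greedy r S p (Suc x) = (if x \<in> S \<and> p < x then greedy_step r (greedy r S p x) x else greedy r S p x)"
  unfolding greedy_def by simp_all

lemma greedy_step_cases:
  assumes "greedy_step r s x \<noteq> 0"
  obtains v where "greedy_step r s x = Suc (Suc v)" "best_candidate r s x v"
proof -
  have ex: "\<exists>v<Suc x. best_candidate r s x v" and s: "s \<noteq> 0"
    using assms unfolding greedy_step_def by (metis, metis)
  show thesis
  proof (rule that)
    show "greedy_step r s x = Suc (Suc (LEAST v. best_candidate r s x v))"
      unfolding greedy_step_def using ex s by (simp only: if_True if_False simp_thms)
    show "best_candidate r s x (LEAST v. best_candidate r s x v)" using ex by (metis LeastI_ex)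
  qed
qed

lemma linear_order_max:
  assumes "Linear_order r" "finite M" "M \<noteq> {}" "M \<subseteq> Field r"
  shows "\<exists>m\<in>M. \<forall>u\<in>M. (u, m) \<in> r"
  using assms(2-)
proof (induction M rule: finite_ne_induct)
  case (singleton x)
  then show ?case using assms(1) unfolding order_on_defs refl_on_def by auto
next
  case (insert x M)
  then obtain m where m: "m \<in> M" "\<forall>u\<in>M. (u, m) \<in> r" by auto
  have refl: "(x, x) \<in> r" using assms(1) insert.prems unfolding order_on_defs refl_on_def by auto
  have trans: "trans r" using assms(1) unfolding order_on_defs by blast
  have "(x, m) \<in> r \<or> (m, x) \<in> r"
    using assms(1) insert.prems m(1) refl unfolding order_on_defs total_on_def by (metis in_mono insert_iff)
  then show ?case
  proof
    assume "(x, m) \<in> r"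
    then show ?thesis using m by blast
  next
    assume "(m, x) \<in> r"
    then have "\<forall>u\<in>insert x M. (u, x) \<in> r" using m(2) refl transD[OF trans] by blast
    then show ?thesis by blast
  qed
qed

text \<open>The step takes the \<open>r\<close>-largest candidate among the numbers up to
  \<open>x\<close>, so it gives away no more of the order than any competitor that is small enough
  to be seen.\<close>

lemma greedy_step_dominates:
  assumes r: "Linear_order r" and s: "s \<noteq> 0" and l: "candidate r s l" "l \<le> x"
  obtains v where "greedy_step r s x = Suc (Suc v)" "(l, v) \<in> r"
proof -
  let ?M = "{u. u < Suc x \<and> candidate r s u}"
  have "?M \<subseteq> Field r" unfolding candidate_def Field_def by auto
  moreover have "l \<in> ?M" using l by simp
  ultimately obtain m where "m \<in> ?M" "\<forall>u\<in>?M. (u, m) \<in> r" using linear_order_max[OF r, of ?M] by auto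
  then have "\<exists>v<Suc x. best_candidate r s x v" unfolding best_candidate_def by blast
  then have "greedy_step r s x \<noteq> 0" using s unfolding greedy_step_def by simp
  then obtain v where v: "greedy_step r s x = Suc (Suc v)" "best_candidate r s x v" by (rule greedy_step_cases)
  then show thesis using that l unfolding best_candidate_def by simp
qed

text \<open>Holds for every infinite \<open>S\<close>, sparse or not: steps keep occurring, and each
  one gets stuck or goes strictly down in \<open>r\<close>. Waiting for state 0 is therefore a total
  computation.\<close>

lemma greedy_dies:
  assumes wf: "wf (r - Id)" and S: "infinite S"
  shows "\<exists>y. greedy r S p y = 0"
proof -
  have next_step: "\<exists>x. greedy r S p (Suc x) = greedy_step r (greedy r S p y) x" for y
  proof -
    let ?R = "\<lambda>x. y \<le> x \<and> x \<in> S \<and> p < x"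
    obtain x0 where "x0 \<in> S" "max y p < x0" using S by (meson infinite_nat_iff_unbounded)
    then have "\<exists>x. ?R x" by (intro exI[of _ x0]) simp
    then have x: "?R (LEAST x. ?R x)" by (rule LeastI_ex)
    have stay: "greedy r S p z = greedy r S p y" if "y \<le> z" "z \<le> (LEAST x. ?R x)" for z
      using that
    proof (induction z rule: dec_induct)
      case (step z)
      then have "\<not> ?R z" by (intro not_less_Least) simp
      then show ?case using step by (auto simp: greedy_Suc)
    qed simp
    show ?thesis using x stay[of "LEAST x. ?R x"] by (intro exI[of _ "LEAST x. ?R x"]) (simp add: greedy_Suc)
  qed
  have dies: "\<exists>y. greedy r S p y = 0" if "greedy r S p y = Suc (Suc v)" for v y
    using that
  proof (induction v arbitrary: y rule: wf_induct_rule[OF wf])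
    case (1 v)
    obtain x where x: "greedy r S p (Suc x) = greedy_step r (Suc (Suc v)) x" using next_step[of y] 1(2) by auto
    show ?case
    proof (cases "greedy_step r (Suc (Suc v)) x = 0")
      case True
      then show ?thesis using x by (intro exI[of _ "Suc x"]) simp
    next
      case False
      then obtain u where u: "greedy_step r (Suc (Suc v)) x = Suc (Suc u)" "best_candidate r (Suc (Suc v)) x u"
        by (rule greedy_step_cases)
      then have "(u, v) \<in> r - Id" unfolding best_candidate_def candidate_def by simp
      then show ?thesis using 1(1) x u(1) by metis
    qed
  qed
  obtain x where x: "greedy r S p (Suc x) = greedy_step r 1 x" using next_step[of 0] by (auto simp: greedy_0)
  show ?thesis
  proof (cases "greedy_step r 1 x = 0")
    case True
    then show ?thesis using x by (intro exI[of _ "Suc x"]) simp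
  next
    case False
    then obtain u where "greedy_step r 1 x = Suc (Suc u)" by (rule greedy_step_cases)
    then show ?thesis using dies x by metis
  qed
qed

lemma rfun_greedy:
  assumes r: "rel_computable {} r" and py: "rfun \<O> k p" "rfun \<O> k y"
  shows "rfun \<O> k (\<lambda>X xs. greedy r X (p X xs) (y X xs))"
proof -
  have cand: "rpred \<O> m (\<lambda>X xs. candidate r (a X xs) (b X xs))" if "rfun \<O> m a" "rfun \<O> m b" for m a b
    unfolding candidate_def
    by (intro rpred_conj rpred_disj rpred_not rpred_eq rpred_of_rel_computable[OF r] rfun_diff rfun_const that)
  have "rpred \<O> 3 (\<lambda>X xs. best_candidate r (xs ! 0) (xs ! 1) (xs ! 2))"
    unfolding best_candidate_def
    by (intro rpred_conj cand rpred_all rpred_imp rpred_of_rel_computable[OF r] rfun_Suc rfun_nth rfun_tl1) simp_all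
  note best = rpred_app3[where P = "\<lambda>X s x v. best_candidate r s x v", OF this]
  have "rfun \<O> 2 (\<lambda>X xs. if xs ! 0 = 0 then 0 else if \<exists>v<Suc (xs ! 1). best_candidate r (xs ! 0) (xs ! 1) v
      then Suc (if \<exists>v<Suc (xs ! 1). best_candidate r (xs ! 0) (xs ! 1) v
        then Suc (LEAST v. best_candidate r (xs ! 0) (xs ! 1) v) else 0) else 0)"
    by (intro rfun_if rpred_eq rpred_ex best rfun_bounded_Least rfun_Suc rfun_const rfun_nth rfun_tl1) simp_all
  then have "rfun \<O> 2 (\<lambda>X xs. greedy_step r (xs ! 0) (xs ! 1))"
    unfolding greedy_step_def by (rule rfun_congI) auto
  note step = rfun_app2[where F = "\<lambda>X. greedy_step r", OF this]
  have "rfun \<O> 2 (\<lambda>X xs. greedy r X (xs ! 0) (xs ! 1))"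
    unfolding greedy_def
    by (intro rfun_rec rfun_if rpred_conj rpred_mem_oracle rpred_less step rfun_const rfun_nth rfun_tl1 rfun_tl2) simp_all
  from rfun_app2[where F = "greedy r", OF this py] show ?thesis .
qed

lemma reservoir_subset:
  assumes "reservoir Cv B F Q X" "Y \<subseteq> X" "infinite Y"
  shows "reservoir Cv B F Q Y"
proof -
  have X: "X \<subseteq> B" "\<forall>x\<in>F. \<forall>y\<in>X. x < y" and av: "avoids Cv Q X"
    using assms(1) unfolding reservoir_def by blast+
  have "avoids Cv Q Y" unfolding avoids_def
  proof (clarify)
    fix e F' n H assume "(e, F', n) \<in> Q" "finite H" "H \<subseteq> Y" "Cv e n (F' \<union> H)"
    then show False using avoidsD[OF av] assms(2) by (meson subset_trans)
  qed
  moreover have "Y \<subseteq> B" using assms(2) X(1) by (rule subset_trans)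
  moreover have "\<forall>x\<in>F. \<forall>y\<in>Y. x < y" using assms(2) X(2) by blast
  ultimately show ?thesis unfolding reservoir_def using assms(3) by (intro conjI)
qed

lemma nodeI:
  assumes G: "\<forall>g\<in>G. t < g" and n: "n < t" "eval_upto t B f [n] \<noteq> None" and safe: "safe B Q e F n G"
  shows "node B Q e F f (insert n (insert t G))"
  unfolding node_def
proof (intro ballI impI)
  let ?K = "insert n (insert t G)"
  fix n' t' assume n': "n' \<in> ?K" and t': "t' \<in> ?K" and H: "n' < t' \<and> (\<forall>z\<in>?K. z = n' \<or> t' \<le> z)"
  have "n \<le> n'" using n' G n(1) by (auto intro: less_imp_le less_trans)
  moreover have "n = n' \<or> t' \<le> n" using H by blast
  ultimately have nn: "n' = n" using H by auto
  have "t = n' \<or> t' \<le> t" using H by blast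
  then have "t' \<le> t" using nn n(1) by simp
  moreover have "t' \<noteq> n" using H nn by simp
  ultimately have tt: "t' = t" using t' G by force
  have "{z \<in> ?K. t < z} = G" using G n(1) by auto
  then show "eval_upto t' B f [n'] \<noteq> None \<and> safe B Q e F n' {z \<in> ?K. t' < z}"
    unfolding nn tt using n(2) safe by simp
qed

lemma computable_ordinal_case:
  assumes fin: "finite F" "finite Q" "\<forall>(e, F, n)\<in>Q. finite F"
    and res: "reservoir converges B F Q X"
    and sound: "\<And>n H. n \<notin> A \<Longrightarrow> finite H \<Longrightarrow> H \<subseteq> X \<Longrightarrow> \<not> converges e n (F \<union> H)"
    and complete: "\<And>n Y. n \<in> A \<Longrightarrow> reservoir converges B F Q Y \<Longrightarrow> \<exists>H\<subseteq>Y. finite H \<and> converges e n (F \<union> H)"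
    and ce: "ce_in B A" and ck: "omega1_eq_ck B"
  shows "\<exists>C\<subseteq>X. infinite C \<and> rpred {S. S \<subseteq> C \<and> infinite S} 1 (\<lambda>S xs. xs ! 0 \<in> A)"
proof -
  obtain f where f: "n \<in> A \<longleftrightarrow> (\<exists>t. eval_upto t B f [n] \<noteq> None)" for n
    using ce unfolding ce_in_def halts_iff_eval_upto by (elim exE) (rule that, erule spec)
  have X: "infinite X" "X \<subseteq> B" "\<And>x y. x \<in> F \<Longrightarrow> y \<in> X \<Longrightarrow> x < y" and av: "avoids converges Q X"
    using res unfolding reservoir_def by blast+
  let ?r = "node_order B Q e F f"
  have "Well_order ?r"
  proof (rule Well_order_node_order)
    fix n t Y assume n: "eval_upto t B f [n] \<noteq> None" and Y: "infinite Y"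
      and safeY: "\<And>H. finite H \<Longrightarrow> H \<subseteq> Y \<Longrightarrow> safe B Q e F n H"
    have "avoids converges Q Y" unfolding avoids_def
    proof (clarify)
      fix e' F' n' H assume q: "(e', F', n') \<in> Q" and H: "finite H" "H \<subseteq> Y" "converges e' n' (F' \<union> H)"
      have "\<forall>q\<in>Q. \<not> appears (fst q) (fst (snd q)) (snd (snd q)) H" using safeY[OF H(1,2)] unfolding safe_def by blast
      from bspec[OF this q] have "\<not> appears e' F' n' H" by simp
      then show False using H(1,3) unfolding appears_def by blast
    qed
    moreover have "y \<in> B \<and> (\<forall>x\<in>F. x < y)" if "y \<in> Y" for y
      using safeY[of "{y}"] that unfolding safe_def by simp
    \<comment> \<open>\<open>Y\<close> need not lie in \<open>X\<close>; completeness for every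
      reservoir of the same condition is essential here.\<close>
    ultimately have "reservoir converges B F Q Y" unfolding reservoir_def using Y by blast
    then obtain H where H: "H \<subseteq> Y" "finite H" "converges e n (F \<union> H)" using complete[of n Y] f n by blast
    then have "appears e F n H" unfolding appears_def by blast
    then show False using safeY[OF H(2,1)] unfolding safe_def by blast
  qed
  then obtain r where r: "Well_order r" "rel_computable {} r" "(?r, r) \<in> ordIso"
    using ck rel_computable_node_order[OF fin, of B e f] unfolding omega1_eq_ck_def by blast
  obtain \<phi> where \<phi>: "iso ?r r \<phi>" using r(3) unfolding ordIso_def by blast
  have lin: "Linear_order r" and wf: "wf (r - Id)" using r(1) unfolding well_order_on_def by blast+
  have trans: "trans r" and antisym: "antisym r" using lin unfolding order_on_defs by blast+
  have \<phi>_mono: "(\<phi> k, \<phi> l) \<in> r" if "(k, l) \<in> ?r" for k l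
    using \<phi> that unfolding iso_iff2 by (meson FieldI1 FieldI2)
  have \<phi>_inj: "\<phi> k \<noteq> \<phi> l" if "(k, l) \<in> ?r" "k \<noteq> l" for k l
    using \<phi> that unfolding iso_iff2 bij_betw_def by (meson FieldI1 FieldI2 inj_onD)
  \<comment> \<open>An arbitrary choice will do: the stage is never computed from \<open>S\<close>,
    only exceeded by its elements. The encoding of nodes requires it to lie above
    \<open>n\<close>.\<close>
  define stage where "stage n = (SOME t. n < t \<and> eval_upto t B f [n] \<noteq> None)" for n
  have stage: "n < stage n" "eval_upto (stage n) B f [n] \<noteq> None" if n: "n \<in> A" for n
  proof -
    obtain t where t: "eval_upto t B f [n] \<noteq> None" using n f by blast
    have "eval_upto (max t (Suc n)) B f [n] \<noteq> None" using t by (rule eval_upto_not_None_mono) simp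
    then have "n < max t (Suc n) \<and> eval_upto (max t (Suc n)) B f [n] \<noteq> None" by simp
    then have "n < stage n \<and> eval_upto (stage n) B f [n] \<noteq> None" unfolding stage_def by (rule someI)
    then show "n < stage n" "eval_upto (stage n) B f [n] \<noteq> None" by blast+
  qed
  define code where "code n G = set_encode (insert n (insert (stage n) G))" for n G
  define lab where "lab n G = \<phi> (code n G)" for n G
  have decode: "set_decode (code n G) = insert n (insert (stage n) G)" if "finite G" for n G
    unfolding code_def using that by simp
  have nodeA: "node B Q e F f (set_decode (code n G))"
    if "n \<in> A" "finite G" "\<forall>g\<in>G. stage n < g" "safe B Q e F n G" for n G
    unfolding decode[OF that(2)] by (rule nodeI[OF that(3) stage[OF that(1)] that(4)])
  have lab_refl: "(lab n G, lab n G) \<in> r"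
    if "n \<in> A" "finite G" "\<forall>g\<in>G. stage n < g" "safe B Q e F n G" for n G
    unfolding lab_def by (rule \<phi>_mono) (use nodeA[OF that] in \<open>simp add: node_order_def\<close>)
  have lab_less: "(lab n (insert x G), lab n G) \<in> r" "lab n (insert x G) \<noteq> lab n G"
    if n: "n \<in> A" and G: "finite G" "\<forall>g\<in>G. stage n < g" "\<forall>g\<in>G. g < x" and x: "stage n < x"
      and safe: "safe B Q e F n (insert x G)" for n G x
  proof -
    let ?K = "insert n (insert (stage n) G)"
    have "x \<notin> ?K" "\<forall>k\<in>?K. k < x" using stage(1)[OF n] G(3) x by auto
    then have "kb_less (insert x ?K) ?K" by (rule kb_less_insert)
    moreover have "insert x ?K = insert n (insert (stage n) (insert x G))" by blast
    ultimately have kb: "kb_less (set_decode (code n (insert x G))) (set_decode (code n G))"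
      using G(1) by (simp add: decode)
    have "node B Q e F f (set_decode (code n (insert x G)))" by (rule nodeA[OF n]) (use G x safe in auto)
    moreover have "node B Q e F f (set_decode (code n G))"
      by (rule nodeA[OF n G(1,2) safe_mono[OF safe]]) blast
    ultimately have ord: "(code n (insert x G), code n G) \<in> ?r" using kb unfolding node_order_def by simp
    have "code n (insert x G) \<noteq> code n G" using kb kb_less_irrefl by metis
    then show "(lab n (insert x G), lab n G) \<in> r" "lab n (insert x G) \<noteq> lab n G"
      unfolding lab_def using \<phi>_mono[OF ord] \<phi>_inj[OF ord] by blast+
  qed
  obtain U where U: "U \<noteq> bot" "\<forall>\<^sub>F x in U. x \<in> X" "\<And>m. \<forall>\<^sub>F x in U. m < x"
    using ex_ultrafilter[OF X(1)] by blast
  \<comment> \<open>The first conjunct puts the elements of \<open>S\<close> above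
    \<open>stage n\<close>, so that \<open>n\<close> and its stage are the two least elements of a
    code. The second brings the labels into the range of the greedy search.\<close>
  define thin where "thin E x \<longleftrightarrow> (\<forall>w\<in>E. \<forall>n\<in>{..w}. stage n < x) \<and> (\<forall>w\<in>E. \<forall>n\<in>{..w}. \<forall>G\<in>Pow E. lab n G < x)" for E x
  have ev: "\<forall>\<^sub>F x in U. thin E x" if "finite E" for E
    unfolding thin_def using that U(3)
    by (intro eventually_conj eventually_ball_finite ballI) simp_all
  obtain Z where Z: "Z \<subseteq> X" "infinite Z" "\<And>z. z \<in> Z \<Longrightarrow> thin (Z \<inter> {..<z}) z"
    by (rule fusion[where P = thin, OF U ev]) (simp_all add: that)
  define \<O> where "\<O> = {S. S \<subseteq> Z \<and> infinite S}"
  have \<O>: "S \<subseteq> Z" "infinite S" "S \<subseteq> X" if "S \<in> \<O>" for S using that Z(1) unfolding \<O>_def by auto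
  \<comment> \<open>For subsets of \<open>X\<close> the promises hold by choice of the reservoir, so
    safety reduces to \<open>n\<close> not having appeared.\<close>
  have safe: "safe B Q e F n G" if G: "G \<subseteq> X" "\<not> appears e F n G" for G n
  proof -
    have "\<not> appears (fst q) (fst (snd q)) (snd (snd q)) G" if q: "q \<in> Q" for q
    proof
      assume "appears (fst q) (fst (snd q)) (snd (snd q)) G"
      then obtain H where H: "H \<subseteq> G" "finite H" "converges (fst q) (snd (snd q)) (fst (snd q) \<union> H)"
        unfolding appears_def by blast
      have "(fst q, fst (snd q), snd (snd q)) \<in> Q" using q by simp
      from avoidsD[OF av this H(2)] H G(1) show False by blast
    qed
    then show ?thesis unfolding safe_def using G X(2,3) by blast
  qed
  \<comment> \<open>Until \<open>n\<close> appears, the label of the current position stays strictly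
    below the greedy state. At \<open>x\<close> the old label is a candidate, so the new state is at
    least this label, while adding \<open>x\<close> makes the label drop strictly.\<close>
  have key: "greedy r S p y \<noteq> 0 \<and> (\<forall>v. greedy r S p y = Suc (Suc v) \<longrightarrow>
      (lab n (S \<inter> {p..<y}), v) \<in> r \<and> lab n (S \<inter> {p..<y}) \<noteq> v)"
    if S: "S \<in> \<O>" and n: "n \<in> A" and p: "p = next_after S n" and "\<not> appears e F n (S \<inter> {p..<y})" for S n p y
    using that(4)
  proof (induction y)
    case 0
    then show ?case by (simp add: greedy_0)
  next
    case (Suc x)
    obtain w where w: "w < p" "w \<in> S" "n \<le> w" using next_after[OF \<O>(2)[OF S], of n] p by blast
    have sparse: "stage n < z" "G \<subseteq> S \<inter> {..<z} \<Longrightarrow> lab n G < z" if z: "z \<in> S" "p \<le> z" for z G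
    proof -
      have "w \<in> Z \<inter> {..<z}" "n \<in> {..w}" "z \<in> Z" "S \<inter> {..<z} \<subseteq> Z \<inter> {..<z}" using w z \<O>(1)[OF S] by auto
      then show "stage n < z" "G \<subseteq> S \<inter> {..<z} \<Longrightarrow> lab n G < z" using Z(3)[of z] unfolding thin_def by blast+
    qed
    \<comment> \<open>No step is taken up to \<open>p\<close>, and the claim about labels is empty
      for the start state 1.\<close>
    have early: "greedy r S p z = 1" if "z \<le> Suc p" for z
      using that by (induction z) (simp_all add: greedy_0 greedy_Suc)
    let ?G = "S \<inter> {p..<x}"
    show ?case
    proof (cases "p < x")
      case False
      then show ?thesis using early[of "Suc x"] by simp
    next
      case px: True
      have "?G \<subseteq> S \<inter> {p..<Suc x}" by auto
      then have "\<not> appears e F n ?G" using Suc.prems appears_mono by blast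
      note IH = Suc.IH[OF this]
      show ?thesis
      proof (cases "x \<in> S")
        case False
        then have "S \<inter> {p..<Suc x} = ?G" "greedy r S p (Suc x) = greedy r S p x"
          by (simp_all add: interval_Int_Suc greedy_Suc)
        then show ?thesis using IH by simp
      next
        case True
        have eq: "S \<inter> {p..<Suc x} = insert x ?G" using True px by (simp add: interval_Int_Suc)
        have safe': "safe B Q e F n (insert x ?G)"
          using Suc.prems \<O>(3)[OF S] True unfolding eq by (intro safe) auto
        have G: "finite ?G" "\<forall>g\<in>?G. stage n < g" "\<forall>g\<in>?G. g < x" using sparse(1) by auto
        have "safe B Q e F n ?G" by (rule safe_mono[OF safe']) blast
        then have "(lab n ?G, lab n ?G) \<in> r" by (rule lab_refl[OF n G(1,2)])
        moreover have "greedy r S p x = 1 \<or> (lab n ?G, greedy r S p x - 2) \<in> r \<and> lab n ?G \<noteq> greedy r S p x - 2"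
        proof (cases "greedy r S p x = 1")
          case False
          then obtain v where "greedy r S p x = Suc (Suc v)" using IH by (metis One_nat_def not0_implies_Suc)
          then show ?thesis using IH by simp
        qed simp
        ultimately have "candidate r (greedy r S p x) (lab n ?G)" unfolding candidate_def by blast
        \<comment> \<open>Sparseness enters here: the label is among the numbers that the greedy
          step at \<open>x\<close> inspects.\<close>
        moreover have "lab n ?G \<le> x" using sparse(2)[OF True, of ?G] px by (simp add: less_imp_le subset_iff)
        ultimately obtain v where v: "greedy_step r (greedy r S p x) x = Suc (Suc v)" "(lab n ?G, v) \<in> r"
          using greedy_step_dominates[OF lin conjunct1[OF IH]] by blast
        have less: "(lab n (insert x ?G), lab n ?G) \<in> r" "lab n (insert x ?G) \<noteq> lab n ?G"
          using lab_less[OF n G _ safe'] sparse(1)[OF True] px by simp_all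
        have "(lab n (insert x ?G), v) \<in> r" using transD[OF trans less(1) v(2)] .
        moreover have "lab n (insert x ?G) \<noteq> v" using antisymD[OF antisym less(1)] less(2) v(2) by blast
        moreover have "greedy r S p (Suc x) = Suc (Suc v)" using True px v(1) by (simp add: greedy_Suc)
        ultimately show ?thesis unfolding eq by simp
      qed
    qed
  qed
  have dies: "\<exists>y. greedy r S p y = 0" if "S \<in> \<O>" for S p using greedy_dies[OF wf \<O>(2)[OF that]] .
  let ?D = "\<lambda>S n. appears e F n (set_decode (set_encode
    (S \<inter> {next_after S n..<LEAST y. greedy r S (next_after S n) y = 0})))"
  have "rpred \<O> 1 (\<lambda>S xs. ?D S (xs ! 0))"
    by (intro rpred_appears fin(1) rfun_nth rfun_encode_interval rfun_next_after rfun_Least rpred_eq rfun_greedy r(2)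
        rfun_const rfun_tl1 \<O> dies) simp_all
  moreover have "?D S n \<longleftrightarrow> n \<in> A" if S: "S \<in> \<O>" for S n
  proof -
    let ?p = "next_after S n"
    let ?y = "LEAST y. greedy r S ?p y = 0"
    have "greedy r S ?p ?y = 0" using dies[OF S] by (rule LeastI_ex)
    then have "appears e F n (S \<inter> {?p..<?y})" if "n \<in> A" using key[OF S that refl, of ?y] by blast
    moreover have "n \<in> A" if a: "appears e F n (S \<inter> {?p..<?y})"
    proof (rule ccontr)
      assume "n \<notin> A"
      obtain H where "H \<subseteq> S \<inter> {?p..<?y}" "finite H" "converges e n (F \<union> H)" using a unfolding appears_def by blast
      then show False using sound[OF \<open>n \<notin> A\<close>, of H] \<O>(3)[OF S] by blast
    qed
    ultimately show ?thesis by auto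
  qed
  ultimately have "rpred \<O> 1 (\<lambda>S xs. xs ! 0 \<in> A)"
    using rpred_cong[of \<O> 1 "\<lambda>S xs. ?D S (xs ! 0)" "\<lambda>S xs. xs ! 0 \<in> A"] by blast
  then show ?thesis using Z(1,2) unfolding \<O>_def by blast
qed

theorem theorem1p5:
  fixes A B :: "nat set"
  assumes "infinite B"
    and "\<forall>S. S \<subseteq> B \<and> infinite S \<longrightarrow> ce_in S A"
    and "omega1_eq_ck B \<or> (infinite A \<and> (\<forall>S. S \<subseteq> A \<and> infinite S \<longrightarrow> ce_in S A))"
  shows "\<exists>C Phi. C \<subseteq> B \<and> infinite C \<and> (\<forall>S. S \<subseteq> C \<and> infinite S \<longrightarrow> computes S Phi A)"
proof -
  have ce: "\<exists>e. \<forall>n. n \<in> A \<longleftrightarrow> (\<exists>m\<in>S. converges e n (S \<inter> {..m}))" if S: "S \<subseteq> B" "infinite S" for S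
  proof -
    have "ce_in S A" using assms(2) S by blast
    then show ?thesis unfolding ce_in_def halts_iff_converges[OF S(2)] .
  qed
  obtain e F Q X where fin: "finite F" "finite Q" "\<forall>(e, F', n)\<in>Q. finite F'"
    and res: "reservoir converges B F Q X"
    and sound: "\<And>n H. n \<notin> A \<Longrightarrow> finite H \<Longrightarrow> H \<subseteq> X \<Longrightarrow> \<not> converges e n (F \<union> H)"
    and complete: "\<And>n Y. n \<in> A \<Longrightarrow> reservoir converges B F Q Y \<Longrightarrow> \<exists>H\<subseteq>Y. finite H \<and> converges e n (F \<union> H)"
    by (rule uniform_on_reservoir[where Cv = converges, OF assms(1) ce not_converges_empty converges_initial_mono])
      (assumption | rule that)+
  have X: "infinite X" "X \<subseteq> B" using res unfolding reservoir_def by blast+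
  have "\<exists>C\<subseteq>X. infinite C \<and> rpred {S. S \<subseteq> C \<and> infinite S} 1 (\<lambda>S xs. xs ! 0 \<in> A)"
    using assms(3)
  proof
    assume "omega1_eq_ck B"
    moreover have "ce_in B A" using assms(1,2) by blast
    ultimately show ?thesis using computable_ordinal_case[OF fin res sound complete] by blast
  next
    assume A: "infinite A \<and> (\<forall>S. S \<subseteq> A \<and> infinite S \<longrightarrow> ce_in S A)"
    show ?thesis
    proof (rule self_introenumerable_case[where P = "appears e F"])
      show "infinite X" by (rule X(1))
      show "rpred \<O> k (\<lambda>Y xs. appears e F (b Y xs) (set_decode (a Y xs)))"
        if "rfun \<O> k b" "rfun \<O> k a" for \<O> k b a by (rule rpred_appears[OF fin(1) that])
      show "appears e F n H'" if "appears e F n H" "H \<subseteq> H'" for n H H' using that by (rule appears_mono)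
      show "n \<in> A" if a: "appears e F n H" "H \<subseteq> X" for n H
      proof (rule ccontr)
        assume "n \<notin> A"
        obtain H' where "H' \<subseteq> H" "finite H'" "converges e n (F \<union> H')" using a(1) unfolding appears_def by blast
        then show False using sound[OF \<open>n \<notin> A\<close>, of H'] a(2) by blast
      qed
      show "\<exists>y. appears e F n (Y \<inter> {..<y})" if Y: "n \<in> A" "Y \<subseteq> X" "infinite Y" for n Y
      proof -
        obtain H where H: "H \<subseteq> Y" "finite H" "converges e n (F \<union> H)"
          using complete[OF Y(1) reservoir_subset[OF res Y(2,3)]] by blast
        obtain y where "H \<subseteq> {..<y}" using H(2) finite_nat_iff_bounded by blast
        then have "H \<subseteq> Y \<inter> {..<y}" using H(1) by blast
        then show ?thesis using H(2,3) unfolding appears_def by blast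
      qed
      show "infinite A" using A by blast
      show "ce_in S A" if "S \<subseteq> A" "infinite S" for S using A that by blast
    qed
  qed
  then obtain C where C: "C \<subseteq> X" "infinite C" and "rpred {S. S \<subseteq> C \<and> infinite S} 1 (\<lambda>S xs. xs ! 0 \<in> A)" by blast
  from computes_uniformlyI[OF this(3)] obtain Phi where "\<forall>S\<in>{S. S \<subseteq> C \<and> infinite S}. computes S Phi A" ..
  then show ?thesis using C X(2) by blast
qed

end
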